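(* Let $(Y_n,\Gamma_n)_{n\in\mathbb{N}_0}$, $Y_n=(X_n,\phi_n)$, be an AIR MCMC chain with parameter $\beta\in(0,1)$ in the setting described in the context, and let $d\colon\mathcal{Y}\times\mathcal{Y}\to[0,\infty)$ be a distance-like function with associated contraction coefficient $\tau(\cdot)$ and eccentricities $E_\gamma$. Assume: (1) there are $M\in[1,\infty)$, $\tau\in[0,1)$ and $k_0\in\mathbb{N}$, independent of $\gamma$, such that $\tau(P_\gamma)\le M$ and $\tau(P_\gamma^{k_0})\le\tau$ for all $\gamma\in\mathcal{I}$; (2) there is $K\in(0,\infty)$ such that $E_\gamma(y)\le K$ for all $\gamma\in\mathcal{I}$ and $y\in\mathcal{Y}$. Let $f\colon\mathcal{X}\to\mathbb{R}$ be a measurable function such that $h=h_f\colon\mathcal{Y}\to\mathbb{R}$, $h(x,\phi)=f(x)$, is bounded and Lipschitz with some constant $L\in(0,\infty)$ with respect to $d$. Then for every $\varepsilon>\frac{1}{1+\beta}-\frac12$, $$\lim_{n\to\infty}\frac{1}{n^{1/2+\varepsilon}}\sum_{j=1}^n\bigl(f(X_j)-\nu(f)\bigr)=0\qquad\text{almost surely}.$$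
   Context: Setting. $(\mathcal{X},\mathcal{F}_\mathcal{X},\nu)$ is a probability space, $(\Phi,\mathcal{F}_\Phi)$ is a measurable space, and $\mathcal{Y}=\mathcal{X}\times\Phi$ with $\mathcal{F}_\mathcal{Y}=\mathcal{F}_\mathcal{X}\otimes\mathcal{F}_\Phi$; these are Polish spaces with their (countably generated) Borel $\sigma$-algebras, and $d_\mathcal{Y}$ denotes a metric inducing the Polish topology of $\mathcal{Y}$. $(\mathcal{I},\mathcal{F}_\mathcal{I})$ is a measurable space. $\{\pi_\gamma\}_{\gamma\in\mathcal{I}}$ is a family of probability measures on $\mathcal{Y}$ and $\{P_\gamma\}_{\gamma\in\mathcal{I}}$ a family of transition kernels on $\mathcal{Y}$ such that for every $\gamma$: $\pi_\gamma(B\times\Phi)=\nu(B)$ for all $B\in\mathcal{F}_\mathcal{X}$; $\pi_\gamma$ is the invariant distribution of $P_\gamma$; $P_\gamma$ is $\psi$-irreducible and aperiodic. Moreover $(y,\gamma)\mapsto P_\gamma(y,A)$ is measurable for every $A\in\mathcal{F}_\mathcal{Y}$. Write $\nu(f)=\int f\,d\nu$. AIR MCMC chain with parameter $\beta>0$. Put $k_j=\lceil j^\beta\rceil$, $T_0=0$, $T_m=\sum_{j=1}^m k_j$. The chain is a process $(Y_n,\Gamma_n)_{n\in\mathbb{N}_0}$ on a probability space $(\Omega,\mathcal{F},\mathbb{P})$ with values in $\mathcal{Y}\times\mathcal{I}$ such that: $(Y_0,\Gamma_0)=(y_0,\gamma_0)$ is deterministic; with $\mathcal{F}_n=\sigma(Y_0,\dots,Y_n,\Gamma_0,\dots,\Gamma_n)$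 one has $\mathbb{P}[Y_{n+1}\in B\mid\mathcal{F}_n]=P_{\Gamma_n}(Y_n,B)$ a.s. for all $B\in\mathcal{F}_\mathcal{Y}$; $\Gamma_n=U_n(Y_0,\dots,Y_n,\Gamma_0,\dots,\Gamma_{n-1})$ for measurable maps $U_n\colon\mathcal{Y}^{n+1}\times\mathcal{I}^n\to\mathcal{I}$; adaptation happens only at the times $T_m$, i.e. $\Gamma_{i_1}=\Gamma_{i_2}$ whenever $i_1,i_2\in\{T_j,\dots,T_{j+1}-1\}$ for some $j$; and $\omega\mapsto\pi_{\Gamma_n(\omega)}(g)$ is measurable for every measurable $g\colon\mathcal{Y}\to\mathbb{R}$ with $\pi_\gamma(|g|)<\infty$ for all $\gamma$. Write $Y_n=(X_n,\phi_n)$ with $X_n\in\mathcal{X}$, $\phi_n\in\Phi$. Distance-like function: $d\colon\mathcal{Y}\times\mathcal{Y}\to[0,\infty)$ that is symmetric, satisfies $d(x,y)=0\iff x=y$, and is lower semi-continuous w.r.t. the product topology induced by $d_\mathcal{Y}$ (no triangle inequality required). Wasserstein-like function: $\mathcal{W}(\mu_1,\mu_2)=\inf_\xi\int d(x,y)\,\xi(dx,dy)$, infimum over all couplings $\xi$ of the probability measures $\mu_1,\mu_2$. Contraction coefficient: $\tau(P_\gamma^\ell)=\sup_{y_1\ne y_2}\mathcal{W}(P_\gamma^\ell(y_1,\cdot),P_\gamma^\ell(y_2,\cdot))/d(y_1,y_2)$. Eccentricity: $E_\gamma(y)=\int_\mathcal{Y}d(y,y')\,\pi_\gamma(dy')$.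 A function $\psi$ is Lipschitz with constant $L$ w.r.t. $d$ if $|\psi(x)-\psi(y)|\le L\,d(x,y)$ for all $x,y$. *)

theory Defs
  imports "HOL-Probability.Probability"
begin

section \<open>Markov kernels on a topological space with its Borel sigma-algebra\<close>

definition markov_kernel :: "('y::topological_space \<Rightarrow> 'y measure) \<Rightarrow> bool" where
  "markov_kernel Q \<longleftrightarrow> Q \<in> borel \<rightarrow>\<^sub>M prob_algebra borel"

primrec kernel_pow :: "('y::topological_space \<Rightarrow> 'y measure) \<Rightarrow> nat \<Rightarrow> 'y \<Rightarrow> 'y measure" where
  "kernel_pow Q 0 y = return borel y"
| "kernel_pow Q (Suc n) y = Q y \<bind> kernel_pow Q n"

definition invariant_dist :: "'y::topological_space measure \<Rightarrow> ('y \<Rightarrow> 'y measure) \<Rightarrow> bool" where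
  "invariant_dist \<mu> Q \<longleftrightarrow>
     (\<forall>A\<in>sets borel. (\<integral>\<^sup>+y. emeasure (Q y) A \<partial>\<mu>) = emeasure \<mu> A)"

text \<open>Irreducibility and aperiodicity follow Meyn and Tweedie, \<^emph>\<open>Markov Chains and Stochastic
  Stability\<close>: \<open>\<psi>\<close> always stands for a maximal irreducibility measure, and a chain is aperiodic
  if it has no \<open>k\<close>-cycle of length \<open>k \<ge> 2\<close> that covers the space up to a \<open>\<psi>\<close>-null set.\<close>

definition irreducibility_measure ::
    "('y::topological_space \<Rightarrow> 'y measure) \<Rightarrow> 'y measure \<Rightarrow> bool" where
  "irreducibility_measure Q \<phi> \<longleftrightarrow>
     sets \<phi> = sets borel \<and> sigma_finite_measure \<phi> \<and> emeasure \<phi> UNIV > 0 \<and>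
     (\<forall>A\<in>sets borel. emeasure \<phi> A > 0 \<longrightarrow> (\<forall>y. \<exists>n\<ge>1. emeasure (kernel_pow Q n y) A > 0))"

definition psi_irreducible ::
    "'y measure \<Rightarrow> ('y::topological_space \<Rightarrow> 'y measure) \<Rightarrow> bool" where
  "psi_irreducible \<psi> Q \<longleftrightarrow>
     irreducibility_measure Q \<psi> \<and>
     (\<forall>\<phi>. irreducibility_measure Q \<phi> \<longrightarrow> absolutely_continuous \<psi> \<phi>)"

definition kernel_cycle ::
    "'y measure \<Rightarrow> ('y::topological_space \<Rightarrow> 'y measure) \<Rightarrow> nat \<Rightarrow> (nat \<Rightarrow> 'y set) \<Rightarrow> bool" where
  "kernel_cycle \<psi> Q k D \<longleftrightarrow>
     (\<forall>i<k. D i \<in> sets borel) \<and> disjoint_family_on D {..<k} \<and>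
     (\<forall>i<k. \<forall>y\<in>D i. emeasure (Q y) (D (Suc i mod k)) = 1) \<and>
     emeasure \<psi> (- (\<Union>i<k. D i)) = 0"

definition aperiodic ::
    "'y measure \<Rightarrow> ('y::topological_space \<Rightarrow> 'y measure) \<Rightarrow> bool" where
  "aperiodic \<psi> Q \<longleftrightarrow> \<not> (\<exists>k\<ge>2. \<exists>D. kernel_cycle \<psi> Q k D)"


section \<open>Distance-like functions and the associated Wasserstein-like quantities\<close>

text \<open>Wasserstein-like values, contraction coefficients and eccentricities may be infinite, hence
  the use of \<^typ>\<open>ennreal\<close>.\<close>

definition lower_semicontinuous :: "('b::topological_space \<Rightarrow> real) \<Rightarrow> bool" where
  "lower_semicontinuous g \<longleftrightarrow> (\<forall>z. \<forall>c<g z. \<forall>\<^sub>F w in nhds z. c < g w)"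

definition distance_like :: "('y::topological_space \<Rightarrow> 'y \<Rightarrow> real) \<Rightarrow> bool" where
  "distance_like d \<longleftrightarrow>
     (\<forall>x y. 0 \<le> d x y) \<and> (\<forall>x y. d x y = d y x) \<and> (\<forall>x y. d x y = 0 \<longleftrightarrow> x = y) \<and>
     lower_semicontinuous (\<lambda>(x, y). d x y)"

definition couplings ::
    "'y::topological_space measure \<Rightarrow> 'y measure \<Rightarrow> ('y \<times> 'y) measure set" where
  "couplings \<mu>1 \<mu>2 =
     {\<xi>. prob_space \<xi> \<and> sets \<xi> = sets (borel \<Otimes>\<^sub>M borel) \<and>
         distr \<xi> borel fst = \<mu>1 \<and> distr \<xi> borel snd = \<mu>2}"

definition wasserstein ::
    "('y::topological_space \<Rightarrow> 'y \<Rightarrow> real) \<Rightarrow> 'y measure \<Rightarrow> 'y measure \<Rightarrow> ennreal" where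
  "wasserstein d \<mu>1 \<mu>2 = (INF \<xi>\<in>couplings \<mu>1 \<mu>2. \<integral>\<^sup>+(x, y). ennreal (d x y) \<partial>\<xi>)"

definition contraction_coeff ::
    "('y::topological_space \<Rightarrow> 'y \<Rightarrow> real) \<Rightarrow> ('y \<Rightarrow> 'y measure) \<Rightarrow> ennreal" where
  "contraction_coeff d Q =
     (SUP (y1, y2)\<in>{(y1, y2). y1 \<noteq> y2}. wasserstein d (Q y1) (Q y2) / ennreal (d y1 y2))"

definition eccentricity :: "('y \<Rightarrow> 'y \<Rightarrow> real) \<Rightarrow> 'y measure \<Rightarrow> 'y \<Rightarrow> ennreal" where
  "eccentricity d \<mu> y = (\<integral>\<^sup>+y'. ennreal (d y y') \<partial>\<mu>)"

definition lipschitz_wrt :: "('y \<Rightarrow> 'y \<Rightarrow> real) \<Rightarrow> real \<Rightarrow> ('y \<Rightarrow> real) \<Rightarrow> bool" where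
  "lipschitz_wrt d L g \<longleftrightarrow> (\<forall>x y. \<bar>g x - g y\<bar> \<le> L * d x y)"


section \<open>AIR MCMC chains\<close>

definition air_time :: "real \<Rightarrow> nat \<Rightarrow> nat" where
  "air_time \<beta> m = (\<Sum>j=1..m. nat \<lceil>real j powr \<beta>\<rceil>)"

definition history_algebra ::
    "'o measure \<Rightarrow> 'i measure \<Rightarrow> (nat \<Rightarrow> 'o \<Rightarrow> 'y::topological_space) \<Rightarrow> (nat \<Rightarrow> 'o \<Rightarrow> 'i) \<Rightarrow>
     nat \<Rightarrow> 'o measure" where
  "history_algebra M J Y \<Gamma> n =
     sigma (space M)
       ({Y i -` A \<inter> space M | i A. i \<le> n \<and> A \<in> sets borel} \<union>
        {\<Gamma> i -` B \<inter> space M | i B. i \<le> n \<and> B \<in> sets J})"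

text \<open>The measurable space \<open>(\<I>, \<F>\<^sub>\<I>)\<close> is represented by \<open>space J\<close> and \<open>sets J\<close>; the measure
  carried by \<open>J\<close> plays no role.  \<open>\<X>\<close> and \<open>\<Phi>\<close> are the types \<open>'x\<close> and \<open>'p\<close>; the sigma-algebra of
  \<open>\<X> \<times> \<Phi>\<close> is the Borel one, which here equals the product of the two Borel sigma-algebras.\<close>

locale air_setting =
  fixes \<nu> :: "'x::polish_space measure"
    and J :: "'i measure"
    and \<pi> :: "'i \<Rightarrow> ('x \<times> 'p::polish_space) measure"
    and P :: "'i \<Rightarrow> 'x \<times> 'p \<Rightarrow> ('x \<times> 'p) measure"
  assumes nu_prob: "prob_space \<nu>" and nu_sets: "sets \<nu> = sets borel"
    and pi_prob: "\<gamma> \<in> space J \<Longrightarrow> prob_space (\<pi> \<gamma>)"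
    and pi_sets: "\<gamma> \<in> space J \<Longrightarrow> sets (\<pi> \<gamma>) = sets borel"
    and kernel: "\<gamma> \<in> space J \<Longrightarrow> markov_kernel (P \<gamma>)"
    and pi_marginal: "\<gamma> \<in> space J \<Longrightarrow> B \<in> sets borel \<Longrightarrow> emeasure (\<pi> \<gamma>) (B \<times> UNIV) = emeasure \<nu> B"
    and invariant: "\<gamma> \<in> space J \<Longrightarrow> invariant_dist (\<pi> \<gamma>) (P \<gamma>)"
    and irreducible_aperiodic:
      "\<gamma> \<in> space J \<Longrightarrow> \<exists>\<psi>. psi_irreducible \<psi> (P \<gamma>) \<and> aperiodic \<psi> (P \<gamma>)"
    and kernel_joint_measurable:
      "A \<in> sets borel \<Longrightarrow> (\<lambda>(y, \<gamma>). emeasure (P \<gamma> y) A) \<in> borel_measurable (borel \<Otimes>\<^sub>M J)"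

locale air_mcmc = air_setting \<nu> J \<pi> P + prob_space M
  for \<nu> :: "'x::polish_space measure"
    and J :: "'i measure"
    and \<pi> :: "'i \<Rightarrow> ('x \<times> 'p::polish_space) measure"
    and P :: "'i \<Rightarrow> 'x \<times> 'p \<Rightarrow> ('x \<times> 'p) measure"
    and M :: "'o measure" +
  fixes \<beta> :: real
    and y0 :: "'x \<times> 'p"
    and \<gamma>0 :: 'i
    and U :: "nat \<Rightarrow> (nat \<Rightarrow> 'x \<times> 'p) \<times> (nat \<Rightarrow> 'i) \<Rightarrow> 'i"
    and Y :: "nat \<Rightarrow> 'o \<Rightarrow> 'x \<times> 'p"
    and \<Gamma> :: "nat \<Rightarrow> 'o \<Rightarrow> 'i"
  assumes beta_pos: "0 < \<beta>"
    and Y_measurable: "Y n \<in> M \<rightarrow>\<^sub>M borel"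
    and Gamma_measurable: "\<Gamma> n \<in> M \<rightarrow>\<^sub>M J"
    and Y_initial: "\<omega> \<in> space M \<Longrightarrow> Y 0 \<omega> = y0"
    and Gamma_initial: "\<omega> \<in> space M \<Longrightarrow> \<Gamma> 0 \<omega> = \<gamma>0"
    and transition:
      "B \<in> sets borel \<Longrightarrow>
         AE \<omega> in M. real_cond_exp M (history_algebra M J Y \<Gamma> n)
                      (indicator (Y (Suc n) -` B \<inter> space M)) \<omega>
                    = measure (P (\<Gamma> n \<omega>) (Y n \<omega>)) B"
    and U_measurable:
      "U n \<in> (\<Pi>\<^sub>M i\<in>{..n}. borel) \<Otimes>\<^sub>M (\<Pi>\<^sub>M i\<in>{..<n}. J) \<rightarrow>\<^sub>M J"
    and Gamma_update:
      "\<omega> \<in> space M \<Longrightarrow> \<Gamma> n \<omega> = U n (\<lambda>i\<in>{..n}. Y i \<omega>, \<lambda>i\<in>{..<n}. \<Gamma> i \<omega>)"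
    and increasingly_rare:
      "i1 \<in> {air_time \<beta> j..<air_time \<beta> (Suc j)} \<Longrightarrow> i2 \<in> {air_time \<beta> j..<air_time \<beta> (Suc j)} \<Longrightarrow>
         \<omega> \<in> space M \<Longrightarrow> \<Gamma> i1 \<omega> = \<Gamma> i2 \<omega>"
    and pi_Gamma_measurable:
      "g \<in> borel_measurable borel \<Longrightarrow> (\<And>\<gamma>. \<gamma> \<in> space J \<Longrightarrow> integrable (\<pi> \<gamma>) g) \<Longrightarrow>
         (\<lambda>\<omega>. \<integral>y. (g y :: real) \<partial>\<pi> (\<Gamma> n \<omega>)) \<in> borel_measurable M"

end

theory Submission
  imports Defs "HOL-Real_Asymp.Real_Asymp"
begin

text \<open>Put \<open>g = h - \<nu>(f)\<close>.  Since every \<open>\<pi>\<^sub>\<gamma>\<close> has marginal \<open>\<nu>\<close>, \<open>g\<close> is centred for all \<open>\<pi>\<^sub>\<gamma>\<close>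
  simultaneously.  Applying a kernel multiplies a Lipschitz constant by at most its contraction
  coefficient, so the eccentricity bound makes \<open>P\<^sub>\<gamma>\<^sup>n g\<close> decay geometrically, uniformly in \<open>\<gamma>\<close>;
  hence the Poisson equation \<open>u\<^sub>\<gamma> - P\<^sub>\<gamma> u\<^sub>\<gamma> = g\<close> has uniformly bounded solutions.  The sum of
  the \<open>g(Y\<^sub>j)\<close> splits into a martingale with bounded increments, a bounded telescoping part, and
  one bounded error per adaptation time.  The martingale is \<open>o(n\<^bsup>1/2+\<epsilon>\<^esup>)\<close> by the
  Azuma--Hoeffding inequality and the Borel--Cantelli lemma, and there are only
  \<open>O(n\<^bsup>1/(1+\<beta>)\<^esup>)\<close> adaptation times up to \<open>n\<close>.\<close>

section \<open>Lipschitz contraction and geometric decay\<close>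

text \<open>Powers of the kernel are studied as iterates \<open>kernel_op Q ^^ n\<close> of this
  operator, so that bounds and measurability follow by plain induction on \<open>n\<close>.\<close>

definition kernel_op :: "('y \<Rightarrow> 'y measure) \<Rightarrow> ('y \<Rightarrow> real) \<Rightarrow> 'y \<Rightarrow> real" where
  "kernel_op Q g y = (\<integral>z. g z \<partial>Q y)"

section \<open>Kernels acting on bounded measurable functions\<close>

lemma markov_kernelD:
  assumes "markov_kernel Q"
  shows "prob_space (Q y)" "sets (Q y) = sets borel" "space (Q y) = UNIV"
proof -
  have "Q y \<in> space (prob_algebra borel)"
    using assms measurable_space[of Q borel "prob_algebra borel" y] by (simp add: markov_kernel_def)
  then show "prob_space (Q y)" "sets (Q y) = sets borel"
    by (auto simp: space_prob_algebra)
  then show "space (Q y) = UNIV" by (metis sets_eq_imp_space_eq space_borel)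
qed

lemma integrable_bounded_borel:
  fixes g :: "_ \<Rightarrow> real"
  assumes "prob_space \<mu>" "sets \<mu> = sets borel" "g \<in> borel_measurable borel" "\<And>y. \<bar>g y\<bar> \<le> C"
  shows "integrable \<mu> g"
proof -
  interpret prob_space \<mu> by fact
  show ?thesis
    by (rule integrable_const_bound[where B=C])
      (use assms in \<open>auto cong: measurable_cong_sets\<close>)
qed

lemma kernel_op_measurable:
  assumes "markov_kernel Q" "g \<in> borel_measurable borel"
  shows "kernel_op Q g \<in> borel_measurable borel"
  unfolding kernel_op_def
  using assms(1) measurable_compose[OF measurable_prob_algebraD
      integral_measurable_subprob_algebra[OF assms(2)]]
  by (simp add: markov_kernel_def)

text \<open>The case split covers functions that are not integrable, whose Bochner integral is 0 by
  convention; \<open>C\<close> is nonnegative because it bounds an absolute value.\<close>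

lemma (in prob_space) abs_expectation_le:
  fixes g :: "_ \<Rightarrow> real"
  assumes "\<And>y. \<bar>g y\<bar> \<le> C"
  shows "\<bar>\<integral>z. g z \<partial>M\<bar> \<le> C"
proof (cases "integrable M g")
  case True
  have "\<bar>\<integral>z. g z \<partial>M\<bar> \<le> (\<integral>z. \<bar>g z\<bar> \<partial>M)" by (rule integral_abs_bound)
  also have "\<dots> \<le> (\<integral>z. C \<partial>M)" using True assms by (intro integral_mono) auto
  finally show ?thesis by (simp add: prob_space)
next
  case False
  then show ?thesis using assms[of undefined] by (simp add: not_integrable_integral_eq)
qed

lemma kernel_op_bounded:
  assumes "markov_kernel Q" "\<And>y. \<bar>g y\<bar> \<le> C"
  shows "\<bar>kernel_op Q g y\<bar> \<le> C"
  unfolding kernel_op_def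
  by (rule prob_space.abs_expectation_le[OF markov_kernelD(1)[OF assms(1)]]) (rule assms(2))

lemma funpow_kernel_op_measurable:
  "markov_kernel Q \<Longrightarrow> g \<in> borel_measurable borel \<Longrightarrow> (kernel_op Q ^^ n) g \<in> borel_measurable borel"
  by (induction n) (auto intro: kernel_op_measurable)

lemma funpow_kernel_op_bounded:
  assumes "markov_kernel Q" "\<And>y. \<bar>g y\<bar> \<le> C"
  shows "\<bar>(kernel_op Q ^^ n) g y\<bar> \<le> C"
  by (induction n arbitrary: y) (auto intro!: kernel_op_bounded assms)

lemma markov_kernel_pow: "markov_kernel Q \<Longrightarrow> markov_kernel (kernel_pow Q n)"
proof (induction n)
  case 0
  have "kernel_pow Q 0 = return borel" by (rule ext) simp
  then show ?case unfolding markov_kernel_def by simp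
next
  case (Suc n)
  have "kernel_pow Q (Suc n) = (\<lambda>y. Q y \<bind> kernel_pow Q n)" by (rule ext) simp
  then show ?case using Suc unfolding markov_kernel_def by (auto intro!: measurable_bind_prob_space)
qed

text \<open>Bridge between the two views of a multi-step transition: the contraction hypothesis
  concerns the measures \<open>kernel_pow Q k\<close>, the decay estimate the iterated operator.
  Integration against a composed kernel is an iterated integral, which gives the induction
  step.\<close>

lemma kernel_op_kernel_pow:
  assumes Q: "markov_kernel Q" and g: "g \<in> borel_measurable borel" and C: "\<And>y. \<bar>g y\<bar> \<le> C"
  shows "kernel_op (kernel_pow Q n) g = (kernel_op Q ^^ n) g"
proof (induction n)
  case 0
  show ?case by (rule ext) (use g in \<open>simp add: kernel_op_def integral_return\<close>)
next
  case (Suc n)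
  have K: "kernel_pow Q n \<in> borel \<rightarrow>\<^sub>M subprob_algebra borel"
    using markov_kernel_pow[OF Q, of n] by (auto simp: markov_kernel_def measurable_prob_algebraD)
  show ?case
  proof
    fix y
    have sy: "sets (Q y) = sets borel" by (rule markov_kernelD[OF Q])
    have "kernel_op (kernel_pow Q (Suc n)) g y = (\<integral>x. (\<integral>z. g z \<partial>kernel_pow Q n x) \<partial>Q y)"
      unfolding kernel_op_def kernel_pow.simps
    proof (rule integral_bind[where K=borel and B=C and B'=1])
      show "kernel_pow Q n \<in> Q y \<rightarrow>\<^sub>M subprob_algebra borel"
        using K sy by (simp cong: measurable_cong_sets)
      show "finite_measure (Q y)" using markov_kernelD(1)[OF Q, of y] by (rule prob_space.axioms)
      show "AE x in Q y. emeasure (kernel_pow Q n x) (space (kernel_pow Q n x)) \<le> ennreal 1"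
        using markov_kernelD(1)[OF markov_kernel_pow[OF Q, of n]]
        by (auto simp: prob_space.emeasure_space_1)
    qed (use g C in auto)
    also have "\<dots> = kernel_op Q (kernel_op (kernel_pow Q n) g) y" by (simp add: kernel_op_def)
    finally show "kernel_op (kernel_pow Q (Suc n)) g y = (kernel_op Q ^^ Suc n) g y" by (simp add: Suc)
  qed
qed

text \<open>The easy half of Kantorovich duality: the Lipschitz bound is integrated against an
  arbitrary coupling, and the infimum is taken last. The inequality lives in \<open>ennreal\<close>
  because the right-hand side may be infinite.\<close>

lemma integral_diff_le_wasserstein:
  fixes g :: "'y::topological_space \<Rightarrow> real"
  assumes g: "g \<in> borel_measurable borel" and C: "\<And>y. \<bar>g y\<bar> \<le> C"
    and lip: "lipschitz_wrt d l g" and l: "0 < l"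
  shows "ennreal (\<bar>(\<integral>x. g x \<partial>\<mu>1) - (\<integral>x. g x \<partial>\<mu>2)\<bar> / l) \<le> wasserstein d \<mu>1 \<mu>2"
  unfolding wasserstein_def
proof (rule INF_greatest)
  fix \<xi> assume "\<xi> \<in> couplings \<mu>1 \<mu>2"
  then have ps: "prob_space \<xi>" and s: "sets \<xi> = sets (borel \<Otimes>\<^sub>M borel)"
    and m1: "\<mu>1 = distr \<xi> borel fst" and m2: "\<mu>2 = distr \<xi> borel snd"
    by (auto simp: couplings_def)
  interpret prob_space \<xi> by fact
  have [measurable]: "fst \<in> \<xi> \<rightarrow>\<^sub>M borel" "snd \<in> \<xi> \<rightarrow>\<^sub>M borel"
    using s by (auto cong: measurable_cong_sets)
  note g[measurable]
  have i1: "integrable \<xi> (\<lambda>z. g (fst z))"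
    by (rule integrable_const_bound[where B=C]) (use C in auto)
  have i2: "integrable \<xi> (\<lambda>z. g (snd z))"
    by (rule integrable_const_bound[where B=C]) (use C in auto)
  have "\<bar>(\<integral>x. g x \<partial>\<mu>1) - (\<integral>x. g x \<partial>\<mu>2)\<bar> = \<bar>\<integral>z. g (fst z) - g (snd z) \<partial>\<xi>\<bar>"
    unfolding m1 m2 using i1 i2 by (simp add: integral_distr)
  also have "\<dots> \<le> (\<integral>z. \<bar>g (fst z) - g (snd z)\<bar> \<partial>\<xi>)" by (rule integral_abs_bound)
  finally have "\<bar>(\<integral>x. g x \<partial>\<mu>1) - (\<integral>x. g x \<partial>\<mu>2)\<bar> / l \<le> (\<integral>z. \<bar>g (fst z) - g (snd z)\<bar> / l \<partial>\<xi>)"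
    using l by (simp add: divide_right_mono)
  then have "ennreal (\<bar>(\<integral>x. g x \<partial>\<mu>1) - (\<integral>x. g x \<partial>\<mu>2)\<bar> / l)
      \<le> ennreal (\<integral>z. \<bar>g (fst z) - g (snd z)\<bar> / l \<partial>\<xi>)" by (rule ennreal_leI)
  also have "\<dots> = (\<integral>\<^sup>+z. ennreal (\<bar>g (fst z) - g (snd z)\<bar> / l) \<partial>\<xi>)"
    using i1 i2 l by (intro nn_integral_eq_integral[symmetric]) auto
  also have "\<dots> \<le> (\<integral>\<^sup>+z. ennreal (d (fst z) (snd z)) \<partial>\<xi>)"
    using lip l by (intro nn_integral_mono ennreal_leI)
      (auto simp: lipschitz_wrt_def pos_divide_le_eq mult.commute)
  finally show "ennreal (\<bar>(\<integral>x. g x \<partial>\<mu>1) - (\<integral>x. g x \<partial>\<mu>2)\<bar> / l)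
      \<le> (\<integral>\<^sup>+(x, y). ennreal (d x y) \<partial>\<xi>)" by (simp add: case_prod_beta')
qed

text \<open>For distinct points, the duality bound is applied to the measures \<open>Q x\<close> and
  \<open>Q y\<close>, whose Wasserstein-like value is at most \<open>b * d x y\<close> by definition
  of the contraction coefficient. On the diagonal both sides vanish.\<close>

lemma lipschitz_kernel_op:
  fixes g :: "'y::topological_space \<Rightarrow> real"
  assumes g: "g \<in> borel_measurable borel" and C: "\<And>y. \<bar>g y\<bar> \<le> C"
    and d: "distance_like d" and lip: "lipschitz_wrt d l g" and l: "0 < l"
    and b: "contraction_coeff d Q \<le> ennreal b" "0 \<le> b"
  shows "lipschitz_wrt d (b * l) (kernel_op Q g)"
  unfolding lipschitz_wrt_def
proof (intro allI)
  fix x y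
  show "\<bar>kernel_op Q g x - kernel_op Q g y\<bar> \<le> b * l * d x y"
  proof (cases "x = y")
    case True
    then show ?thesis using d by (metis distance_like_def abs_zero diff_self mult_zero_right order_refl)
  next
    case False
    then have dp: "0 < d x y" using d by (metis distance_like_def less_eq_real_def)
    have "wasserstein d (Q x) (Q y) / ennreal (d x y) \<le> contraction_coeff d Q"
      unfolding contraction_coeff_def using False by (intro SUP_upper2[where i="(x,y)"]) auto
    then have "wasserstein d (Q x) (Q y) / ennreal (d x y) \<le> ennreal b" using b by simp
    \<comment> \<open>The factor \<open>d x y\<close> is positive and finite, so the division in
      \<open>ennreal\<close> can be undone.\<close>
    then have "wasserstein d (Q x) (Q y) / ennreal (d x y) * ennreal (d x y) \<le> ennreal b * ennreal (d x y)"
      by (rule mult_right_mono) simp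
    then have "wasserstein d (Q x) (Q y) \<le> ennreal b * ennreal (d x y)"
      using dp by (simp add: ennreal_divide_times ennreal_divide_self)
    then have "ennreal (\<bar>kernel_op Q g x - kernel_op Q g y\<bar> / l) \<le> ennreal (b * d x y)"
      using integral_diff_le_wasserstein[OF g C lip l, of "Q x" "Q y"] b dp
      unfolding kernel_op_def by (simp add: ennreal_mult)
    then have "\<bar>kernel_op Q g x - kernel_op Q g y\<bar> / l \<le> b * d x y"
      using b dp by (simp add: ennreal_le_iff)
    then show ?thesis using l by (simp add: pos_divide_le_eq mult_ac)
  qed
qed

lemma lipschitz_funpow_kernel_op:
  fixes g :: "'y::topological_space \<Rightarrow> real"
  assumes Q: "markov_kernel Q"
    and g: "g \<in> borel_measurable borel" and C: "\<And>y. \<bar>g y\<bar> \<le> C"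
    and d: "distance_like d" and lip: "lipschitz_wrt d l g" and l: "0 < l"
    and b: "contraction_coeff d Q \<le> ennreal b" "0 < b"
  shows "lipschitz_wrt d (b ^ n * l) ((kernel_op Q ^^ n) g)"
proof (induction n)
  case (Suc n)
  have "lipschitz_wrt d (b * (b ^ n * l)) (kernel_op Q ((kernel_op Q ^^ n) g))"
    using b l by (intro lipschitz_kernel_op[OF funpow_kernel_op_measurable[OF Q g] funpow_kernel_op_bounded[OF Q C] d Suc]) auto
  then show ?case by (simp add: mult.assoc)
qed (use lip in simp)

text \<open>Averaging \<open>\<bar>g y - g z\<bar> \<le> l * d y z\<close> over \<open>z\<close>
  turns a Lipschitz constant into a pointwise bound on the distance of \<open>g\<close> from its
  mean.\<close>

lemma abs_le_eccentricity:
  fixes g :: "'y::topological_space \<Rightarrow> real"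
  assumes \<mu>: "prob_space \<mu>" "sets \<mu> = sets borel"
    and g: "g \<in> borel_measurable borel" and C: "\<And>y. \<bar>g y\<bar> \<le> C"
    and lip: "lipschitz_wrt d l g" and l: "0 < l"
    and K: "eccentricity d \<mu> y \<le> ennreal K" "0 \<le> K"
  shows "\<bar>g y - (\<integral>z. g z \<partial>\<mu>)\<bar> \<le> l * K"
proof -
  interpret prob_space \<mu> by fact
  have ig: "integrable \<mu> g" by (rule integrable_bounded_borel[OF \<mu> g C])
  have "\<bar>g y - (\<integral>z. g z \<partial>\<mu>)\<bar> = \<bar>\<integral>z. g y - g z \<partial>\<mu>\<bar>"
    using ig by (simp add: prob_space)
  also have "\<dots> \<le> (\<integral>z. \<bar>g y - g z\<bar> \<partial>\<mu>)" by (rule integral_abs_bound)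
  finally have "\<bar>g y - (\<integral>z. g z \<partial>\<mu>)\<bar> / l \<le> (\<integral>z. \<bar>g y - g z\<bar> / l \<partial>\<mu>)"
    using l by (simp add: divide_right_mono)
  then have "ennreal (\<bar>g y - (\<integral>z. g z \<partial>\<mu>)\<bar> / l) \<le> ennreal (\<integral>z. \<bar>g y - g z\<bar> / l \<partial>\<mu>)"
    by (rule ennreal_leI)
  also have "\<dots> = (\<integral>\<^sup>+z. ennreal (\<bar>g y - g z\<bar> / l) \<partial>\<mu>)"
    using ig l by (intro nn_integral_eq_integral[symmetric]) auto
  also have "\<dots> \<le> eccentricity d \<mu> y" unfolding eccentricity_def
    using lip l by (intro nn_integral_mono ennreal_leI)
      (auto simp: lipschitz_wrt_def pos_divide_le_eq mult.commute)
  also have "\<dots> \<le> ennreal K" by fact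
  finally show ?thesis using K l by (simp add: pos_divide_le_eq mult.commute)
qed

lemma integral_kernel_op_invariant:
  assumes \<mu>: "prob_space \<mu>" "sets \<mu> = sets borel" and Q: "markov_kernel Q"
    and inv: "invariant_dist \<mu> Q"
    and g: "g \<in> borel_measurable borel" and C: "\<And>y. \<bar>g y\<bar> \<le> C"
  shows "(\<integral>y. kernel_op Q g y \<partial>\<mu>) = (\<integral>y. g y \<partial>\<mu>)"
proof -
  have Q': "Q \<in> \<mu> \<rightarrow>\<^sub>M subprob_algebra borel"
    using Q \<mu> by (auto simp: markov_kernel_def measurable_prob_algebraD cong: measurable_cong_sets)
  have ne: "space \<mu> \<noteq> {}" using \<mu> by (simp add: prob_space.not_empty)
  \<comment> \<open>Invariance is restated as an equality of measures, so that the integral of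
    \<open>g\<close> can be unfolded through the bind.\<close>
  have eq: "\<mu> \<bind> Q = \<mu>"
  proof (rule measure_eqI)
    show s: "sets (\<mu> \<bind> Q) = sets \<mu>"
      using sets_bind[OF _ ne, of Q borel] markov_kernelD(2)[OF Q] \<mu> by simp
    fix A assume "A \<in> sets (\<mu> \<bind> Q)"
    then have A: "A \<in> sets borel" using s \<mu> by simp
    show "emeasure (\<mu> \<bind> Q) A = emeasure \<mu> A"
      using inv A by (simp add: emeasure_bind[OF ne Q' A] invariant_dist_def)
  qed
  have "(\<integral>y. g y \<partial>(\<mu> \<bind> Q)) = (\<integral>y. kernel_op Q g y \<partial>\<mu>)"
    unfolding kernel_op_def
  proof (rule integral_bind[where K=borel and B=C and B'=1])
    show "finite_measure \<mu>" using \<mu>(1) by (rule prob_space.axioms)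
    show "AE x in \<mu>. emeasure (Q x) (space (Q x)) \<le> ennreal 1"
      using markov_kernelD(1)[OF Q] by (auto simp: prob_space.emeasure_space_1)
  qed (use g C Q' in auto)
  then show ?thesis by (simp add: eq)
qed

lemma integral_funpow_kernel_op_invariant:
  assumes \<mu>: "prob_space \<mu>" "sets \<mu> = sets borel" and Q: "markov_kernel Q"
    and inv: "invariant_dist \<mu> Q"
    and g: "g \<in> borel_measurable borel" and C: "\<And>y. \<bar>g y\<bar> \<le> C"
  shows "(\<integral>y. (kernel_op Q ^^ n) g y \<partial>\<mu>) = (\<integral>y. g y \<partial>\<mu>)"
  by (induction n) (simp_all add: integral_kernel_op_invariant[OF \<mu> Q inv funpow_kernel_op_measurable[OF Q g] funpow_kernel_op_bounded[OF Q C]])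

text \<open>Split \<open>n\<close> into \<open>n div k\<close> blocks of length \<open>k\<close> and
  fewer than \<open>k\<close> single steps. Each block multiplies the Lipschitz constant by
  \<open>t\<close>, each single step by \<open>b\<close>. By invariance all iterates stay centred,
  so the eccentricity turns the Lipschitz constant into a bound on the values.\<close>

lemma funpow_kernel_op_geometric:
  fixes g :: "'y::topological_space \<Rightarrow> real"
  assumes \<mu>: "prob_space \<mu>" "sets \<mu> = sets borel" and Q: "markov_kernel Q"
    and inv: "invariant_dist \<mu> Q"
    and g: "g \<in> borel_measurable borel" and C: "\<And>y. \<bar>g y\<bar> \<le> C" and g0: "(\<integral>y. g y \<partial>\<mu>) = 0"
    and d: "distance_like d" and lip: "lipschitz_wrt d l g" and l: "0 < l"
    and b: "contraction_coeff d Q \<le> ennreal b" "1 \<le> b"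
    and t: "contraction_coeff d (kernel_pow Q k) \<le> ennreal t" "0 < t" "t < 1" and k: "1 \<le> k"
    and K: "eccentricity d \<mu> y \<le> ennreal K" "0 \<le> K"
  shows "\<bar>(kernel_op Q ^^ n) g y\<bar> \<le> (b ^ k * l * K / t) * (t powr (1 / k)) ^ n"
proof -
  have Qk: "markov_kernel (kernel_pow Q k)" by (rule markov_kernel_pow[OF Q])
  define q where "q = n div k"
  define r where "r = n mod k"
  have km: "kernel_op (kernel_pow Q k) f = (kernel_op Q ^^ k) f" 
    if "f \<in> borel_measurable borel" "\<And>y. \<bar>f y\<bar> \<le> C" for f using kernel_op_kernel_pow[OF Q that] .
  have *: "((kernel_op Q ^^ k) ^^ j) g = (kernel_op (kernel_pow Q k) ^^ j) g" for j
    by (induction j) (simp_all add: km funpow_kernel_op_measurable[OF Qk g] funpow_kernel_op_bounded[OF Qk C])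
  \<comment> \<open>The blocks act on \<open>g\<close> first and the \<open>r\<close> leftover
    single steps come last.\<close>
  have "n = r + k * q" by (simp add: q_def r_def)
  then have "(kernel_op Q ^^ n) g = (kernel_op Q ^^ r) (((kernel_op Q ^^ k) ^^ q) g)"
    by (simp add: funpow_add funpow_mult)
  then have n: "(kernel_op Q ^^ n) g = (kernel_op Q ^^ r) ((kernel_op (kernel_pow Q k) ^^ q) g)"
    by (simp add: *)
  have "lipschitz_wrt d (t ^ q * l) ((kernel_op (kernel_pow Q k) ^^ q) g)"
    by (rule lipschitz_funpow_kernel_op[OF Qk g C d lip l t(1,2)])
  then have "lipschitz_wrt d (b ^ r * (t ^ q * l)) ((kernel_op Q ^^ n) g)"
    unfolding n using b l t
    by (intro lipschitz_funpow_kernel_op[OF Q funpow_kernel_op_measurable[OF Qk g] funpow_kernel_op_bounded[OF Qk C] d]) auto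
  then have "\<bar>(kernel_op Q ^^ n) g y - (\<integral>z. (kernel_op Q ^^ n) g z \<partial>\<mu>)\<bar> \<le> (b ^ r * (t ^ q * l)) * K"
    using b l t by (intro abs_le_eccentricity[OF \<mu> funpow_kernel_op_measurable[OF Q g] funpow_kernel_op_bounded[OF Q C] _ _ K]) auto
  then have "\<bar>(kernel_op Q ^^ n) g y\<bar> \<le> b ^ r * t ^ q * (l * K)"
    using integral_funpow_kernel_op_invariant[OF \<mu> Q inv g C, of n] g0 by (simp add: mult_ac)
  also have "\<dots> \<le> b ^ k * ((t powr (1 / k)) ^ n / t) * (l * K)"
  proof (intro mult_right_mono mult_mono)
    show "b ^ r \<le> b ^ k" using b k by (intro power_increasing) (auto simp: r_def less_imp_le)
    \<comment> \<open>Rounding \<open>n / k\<close> down loses less than 1 in the exponent; since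
      \<open>t < 1\<close>, this costs at most the factor \<open>1 / t\<close>.\<close>
    have "real n / k - 1 \<le> real q"
    proof -
      have "r < k" using k by (simp add: r_def)
      then have "real n \<le> k * (real q + 1)" using \<open>n = r + k * q\<close> by (simp add: algebra_simps)
      then show ?thesis using k by (simp add: field_simps)
    qed
    then have "t powr real q \<le> t powr (real n / k - 1)" using t by (intro powr_mono') auto
    also have "\<dots> = (t powr (1 / k)) ^ n / t"
      using t by (simp add: powr_diff powr_power)
    finally show "t ^ q \<le> (t powr (1 / k)) ^ n / t" using t by (simp add: powr_realpow)
  qed (use b t l K in auto)
  finally show ?thesis by (simp add: field_simps)
qed

text \<open>Pushing \<open>L x\<close> forward along \<open>y \<mapsto> (x, y)\<close> moves the
  dependence on \<open>x\<close> from the integrand into the measure, leaving a fixed function on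
  the product space.\<close>

lemma integral_measurable_subprob_algebra2:
  fixes f :: "'a \<Rightarrow> 'b \<Rightarrow> real"
  assumes f[measurable]: "(\<lambda>(x, y). f x y) \<in> borel_measurable (M \<Otimes>\<^sub>M N)"
  assumes L[measurable]: "L \<in> M \<rightarrow>\<^sub>M subprob_algebra N"
  shows "(\<lambda>x. \<integral>y. f x y \<partial>L x) \<in> borel_measurable M"
proof -
  note integral_measurable_subprob_algebra[measurable] measurable_distr2[measurable]
  have "(\<lambda>x. integral\<^sup>L (distr (L x) (M \<Otimes>\<^sub>M N) (\<lambda>y. (x, y))) (\<lambda>(x, y). f x y)) \<in> borel_measurable M"
    by measurable
  then show ?thesis
    by (rule measurable_cong[THEN iffD1, rotated]) (simp add: integral_distr)
qed

section \<open>The Poisson equation\<close>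

lemma summable_funpow_kernel_op:
  assumes "\<And>n y. \<bar>(kernel_op Q ^^ n) g y\<bar> \<le> A * r ^ n" and r: "0 \<le> r" "r < 1"
  shows "summable (\<lambda>n. \<bar>(kernel_op Q ^^ n) g y\<bar>)" "summable (\<lambda>n. (kernel_op Q ^^ n) g y)"
proof -
  have "summable (\<lambda>n. A * r ^ n)" using r by (intro summable_mult summable_geometric) simp
  then show "summable (\<lambda>n. \<bar>(kernel_op Q ^^ n) g y\<bar>)"
    by (rule summable_comparison_test'[where N=0]) (simp add: assms)
  then show "summable (\<lambda>n. (kernel_op Q ^^ n) g y)" by (rule summable_rabs_cancel)
qed

text \<open>The Neumann series for the inverse of identity minus \<open>kernel_op Q\<close>, applied
  to \<open>g\<close>. It converges absolutely under the geometric bound.\<close>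

definition poisson_solution :: "('y \<Rightarrow> 'y measure) \<Rightarrow> ('y \<Rightarrow> real) \<Rightarrow> 'y \<Rightarrow> real" where
  "poisson_solution Q g y = (\<Sum>n. (kernel_op Q ^^ n) g y)"

lemma poisson_solution_bounded:
  assumes A: "\<And>n y. \<bar>(kernel_op Q ^^ n) g y\<bar> \<le> A * r ^ n" and r: "0 \<le> r" "r < 1"
  shows "\<bar>poisson_solution Q g y\<bar> \<le> A / (1 - r)"
proof -
  have "\<bar>poisson_solution Q g y\<bar> \<le> (\<Sum>n. \<bar>(kernel_op Q ^^ n) g y\<bar>)"
    unfolding poisson_solution_def by (rule summable_rabs[OF summable_funpow_kernel_op(1)[OF assms]])
  also have "\<dots> \<le> (\<Sum>n. A * r ^ n)"
    using A r by (intro suminf_le summable_funpow_kernel_op(1)[OF assms] summable_mult summable_geometric) auto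
  also have "\<dots> = A / (1 - r)"
    using r by (simp add: suminf_mult summable_geometric suminf_geometric)
  finally show ?thesis .
qed

text \<open>Applying the kernel term by term shifts the series by one index, so only the head
  \<open>g y\<close> is left in the difference. The geometric bound justifies exchanging sum and
  integral.\<close>

lemma poisson_equation:
  assumes Q: "markov_kernel Q" and g: "g \<in> borel_measurable borel"
    and A: "\<And>n y. \<bar>(kernel_op Q ^^ n) g y\<bar> \<le> A * r ^ n" and r: "0 \<le> r" "r < 1"
  shows "poisson_solution Q g y - kernel_op Q (poisson_solution Q g) y = g y"
proof -
  interpret prob_space "Q y" by (rule markov_kernelD[OF Q])
  note sm = summable_funpow_kernel_op[OF A r]
  have i: "integrable (Q y) ((kernel_op Q ^^ n) g)" for n
    by (rule integrable_bounded_borel[OF markov_kernelD(1,2)[OF Q] funpow_kernel_op_measurable[OF Q g] A])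
  have "kernel_op Q (poisson_solution Q g) y = (\<Sum>n. \<integral>z. (kernel_op Q ^^ n) g z \<partial>Q y)"
    unfolding kernel_op_def[of Q "poisson_solution Q g"] poisson_solution_def
  proof (rule integral_suminf[OF i])
    show "AE z in Q y. summable (\<lambda>n. norm ((kernel_op Q ^^ n) g z))" using sm(1) by simp
    have "summable (\<lambda>n. A * r ^ n)" using r by (intro summable_mult summable_geometric) simp
    then show "summable (\<lambda>n. \<integral>z. norm ((kernel_op Q ^^ n) g z) \<partial>Q y)"
    proof (rule summable_comparison_test'[where N=0])
      fix n
      show "norm (\<integral>z. norm ((kernel_op Q ^^ n) g z) \<partial>Q y) \<le> A * r ^ n"
        using abs_expectation_le[of "\<lambda>z. \<bar>(kernel_op Q ^^ n) g z\<bar>" "A * r ^ n"] A by simp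
    qed
  qed
  also have "\<dots> = (\<Sum>n. (kernel_op Q ^^ Suc n) g y)" by (simp add: kernel_op_def)
  also have "\<dots> = poisson_solution Q g y - g y"
    unfolding poisson_solution_def using suminf_split_head[OF sm(2)] by simp
  finally show ?thesis by simp
qed

section \<open>Joint measurability in the parameter and the state\<close>

context air_setting
begin

text \<open>Upgrades measurability of each \<open>emeasure (P \<gamma> y) A\<close> to measurability
  of a measure-valued map, which can then be composed with the random pair of parameter and
  state.\<close>

lemma kernel_measurable: "(\<lambda>(\<gamma>, y). P \<gamma> y) \<in> J \<Otimes>\<^sub>M borel \<rightarrow>\<^sub>M prob_algebra borel"
proof (rule measurable_prob_algebraI)
  fix z :: "'i \<times> 'x \<times> 'p" assume "z \<in> space (J \<Otimes>\<^sub>M borel)"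
  then show "prob_space (case z of (\<gamma>, y) \<Rightarrow> P \<gamma> y)"
    by (auto simp: space_pair_measure intro: markov_kernelD kernel)
next
  show "(\<lambda>(\<gamma>, y). P \<gamma> y) \<in> J \<Otimes>\<^sub>M borel \<rightarrow>\<^sub>M subprob_algebra borel"
  proof (rule measurable_subprob_algebra)
    fix z :: "'i \<times> 'x \<times> 'p" assume "z \<in> space (J \<Otimes>\<^sub>M borel)"
    then show "subprob_space (case z of (\<gamma>, y) \<Rightarrow> P \<gamma> y)" "sets (case z of (\<gamma>, y) \<Rightarrow> P \<gamma> y) = sets borel"
      using markov_kernelD[OF kernel] by (auto simp: space_pair_measure prob_space_imp_subprob_space)
  next
    fix A :: "('x \<times> 'p) set" assume "A \<in> sets borel"
    note [measurable] = kernel_joint_measurable[OF this]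
    have "(\<lambda>z. (\<lambda>(y, \<gamma>). emeasure (P \<gamma> y) A) (snd z, fst z)) \<in> borel_measurable (J \<Otimes>\<^sub>M borel)"
      by measurable
    then show "(\<lambda>z. emeasure (case z of (\<gamma>, y) \<Rightarrow> P \<gamma> y) A) \<in> borel_measurable (J \<Otimes>\<^sub>M borel)"
      by (simp add: case_prod_beta')
  qed
qed

lemma kernel_op_joint_measurable:
  assumes u[measurable]: "(\<lambda>(\<gamma>, y). u \<gamma> y) \<in> borel_measurable (J \<Otimes>\<^sub>M borel)"
  shows "(\<lambda>(\<gamma>, y). kernel_op (P \<gamma>) (u \<gamma>) y) \<in> borel_measurable (J \<Otimes>\<^sub>M borel)"
proof -
  have "(\<lambda>x. \<integral>z. u (fst x) z \<partial>(\<lambda>(\<gamma>, y). P \<gamma> y) x) \<in> borel_measurable (J \<Otimes>\<^sub>M borel)"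
    by (rule integral_measurable_subprob_algebra2[OF _ measurable_prob_algebraD[OF kernel_measurable]])
      measurable
  then show ?thesis by (simp add: kernel_op_def case_prod_beta')
qed

text \<open>The solution is evaluated at the random parameter \<open>\<Gamma> k \<omega>\<close>, so
  measurability for each fixed parameter would not suffice. It passes through the iterates by
  induction and then to the countable sum.\<close>

lemma poisson_solution_joint_measurable:
  assumes g[measurable]: "g \<in> borel_measurable borel"
  shows "(\<lambda>(\<gamma>, y). poisson_solution (P \<gamma>) g y) \<in> borel_measurable (J \<Otimes>\<^sub>M borel)"
proof -
  have [measurable]: "(\<lambda>(\<gamma>, y). (kernel_op (P \<gamma>) ^^ n) g y) \<in> borel_measurable (J \<Otimes>\<^sub>M borel)" for n
    by (induction n) (simp_all add: kernel_op_joint_measurable)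
  show ?thesis unfolding poisson_solution_def by measurable
qed

end

section \<open>The martingale part\<close>

context air_mcmc
begin

section \<open>The history filtration and the one-step transition law\<close>

abbreviation "hist \<equiv> history_algebra M J Y \<Gamma>"

lemma space_hist [simp]: "space (hist n) = space M"
  by (auto simp: history_algebra_def intro!: space_measure_of)

lemma sets_hist_gen:
  "sets (hist n) = sigma_sets (space M)
       ({Y i -` A \<inter> space M | i A. i \<le> n \<and> A \<in> sets borel} \<union>
        {\<Gamma> i -` B \<inter> space M | i B. i \<le> n \<and> B \<in> sets J})"
  unfolding history_algebra_def by (rule sets_measure_of) auto

lemma subalgebra_hist: "subalgebra M (hist n)"
  unfolding subalgebra_def sets_hist_gen
  by (auto intro!: sets.sigma_sets_subset measurable_sets[OF Y_measurable] measurable_sets[OF Gamma_measurable])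

lemma Y_hist: "i \<le> n \<Longrightarrow> Y i \<in> hist n \<rightarrow>\<^sub>M borel"
  by (rule measurableI) (simp, simp add: sets_hist_gen, rule sigma_sets.Basic, blast)

lemma Gamma_hist: 
  assumes "i \<le> n"
  shows "\<Gamma> i \<in> hist n \<rightarrow>\<^sub>M J"
proof (rule measurableI)
  show "\<And>x. x \<in> space (hist n) \<Longrightarrow> \<Gamma> i x \<in> space J"
    using measurable_space[OF Gamma_measurable] by simp
qed (simp add: sets_hist_gen, rule sigma_sets.Basic, use assms in blast)

lemma Gamma_in: "\<omega> \<in> space M \<Longrightarrow> \<Gamma> n \<omega> \<in> space J"
  using measurable_space[OF Gamma_measurable] .

lemma transition_kernel_hist: "(\<lambda>\<omega>. P (\<Gamma> n \<omega>) (Y n \<omega>)) \<in> hist n \<rightarrow>\<^sub>M prob_algebra borel"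
proof -
  have "(\<lambda>\<omega>. (\<Gamma> n \<omega>, Y n \<omega>)) \<in> hist n \<rightarrow>\<^sub>M J \<Otimes>\<^sub>M borel"
    by (intro measurable_Pair Y_hist Gamma_hist) auto
  from measurable_compose[OF this kernel_measurable] show ?thesis by simp
qed

text \<open>The transition assumption integrated over a past event \<open>A\<close>, by the defining
  property of conditional expectation.\<close>

lemma transition_rectangle:
  assumes A: "A \<in> sets (hist n)" and B: "B \<in> sets borel"
  shows "emeasure M (A \<inter> (Y (Suc n) -` B \<inter> space M)) =
    (\<integral>\<^sup>+\<omega>. indicator A \<omega> * emeasure (P (\<Gamma> n \<omega>) (Y n \<omega>)) B \<partial>M)"
proof -
  interpret H: finite_measure_subalgebra M "hist n"
    by unfold_locales (rule subalgebra_hist)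
  have AM[measurable]: "A \<in> sets M" using A subalgebra_hist[of n] by (auto simp: subalgebra_def)
  have YB[measurable]: "Y (Suc n) -` B \<inter> space M \<in> sets M"
    by (rule measurable_sets[OF Y_measurable B])
  have k[measurable]: "(\<lambda>\<omega>. P (\<Gamma> n \<omega>) (Y n \<omega>)) \<in> M \<rightarrow>\<^sub>M prob_algebra borel"
    by (rule measurable_from_subalg[OF subalgebra_hist transition_kernel_hist])
  have pm[measurable]: "(\<lambda>\<omega>. measure (P (\<Gamma> n \<omega>) (Y n \<omega>)) B) \<in> borel_measurable M"
    by (rule measurable_compose[OF k measurable_measure_prob_algebra[OF B]])
  have ps: "prob_space (P (\<Gamma> n \<omega>) (Y n \<omega>))" if "\<omega> \<in> space M" for \<omega>
    by (rule markov_kernelD(1)[OF kernel[OF Gamma_in[OF that]]])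
  let ?R = "\<lambda>\<omega>. indicator A \<omega> * measure (P (\<Gamma> n \<omega>) (Y n \<omega>)) B"
  have i: "integrable M ?R"
    by (rule integrable_const_bound[where B=1])
      (auto simp: indicator_def ps prob_space.prob_le_1)
  have "measure M (A \<inter> (Y (Suc n) -` B \<inter> space M)) =
     (\<integral>\<omega>\<in>A. indicator (Y (Suc n) -` B \<inter> space M) \<omega> \<partial>M)"
    by (simp add: set_lebesgue_integral_def indicator_inter_arith[symmetric] Int_absorb2)
  also have "\<dots> = (\<integral>\<omega>\<in>A. real_cond_exp M (hist n) (indicator (Y (Suc n) -` B \<inter> space M)) \<omega> \<partial>M)"
    by (rule H.real_cond_exp_intA[OF _ A], intro integrable_real_indicator) (auto simp: less_top[symmetric])
  also have "\<dots> = (\<integral>\<omega>. ?R \<omega> \<partial>M)"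
    unfolding set_lebesgue_integral_def using transition[OF B, of n]
    by (intro integral_cong_AE) auto
  finally have "emeasure M (A \<inter> (Y (Suc n) -` B \<inter> space M)) = ennreal (\<integral>\<omega>. ?R \<omega> \<partial>M)"
    by (simp add: emeasure_eq_measure)
  also have "\<dots> = (\<integral>\<^sup>+\<omega>. ennreal (?R \<omega>) \<partial>M)"
    by (rule nn_integral_eq_integral[symmetric, OF i]) auto
  also have "\<dots> = (\<integral>\<^sup>+\<omega>. indicator A \<omega> * emeasure (P (\<Gamma> n \<omega>) (Y n \<omega>)) B \<partial>M)"
    using ps by (intro nn_integral_cong)
      (auto simp: indicator_def finite_measure.emeasure_eq_measure prob_space.finite_measure)
  finally show ?thesis .
qed

lemma measurable_hist_pair:
  "(\<lambda>\<omega>. (\<omega>, Y (Suc n) \<omega>)) \<in> M \<rightarrow>\<^sub>M hist n \<Otimes>\<^sub>M borel"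
  by (intro measurable_Pair measurable_from_subalg[OF subalgebra_hist[of n] measurable_ident_sets[OF refl]]
      Y_measurable)

lemma measurable_hist_kernel:
  "(\<lambda>\<omega>. distr (P (\<Gamma> n \<omega>) (Y n \<omega>)) (hist n \<Otimes>\<^sub>M borel) (Pair \<omega>))
    \<in> M \<rightarrow>\<^sub>M subprob_algebra (hist n \<Otimes>\<^sub>M borel)"
  by (intro measurable_prob_algebraD measurable_from_subalg[OF subalgebra_hist[of n]]
      measurable_distr_prob_space2[OF transition_kernel_hist]) simp

text \<open>The joint law of the past and the next state. The past is represented by
  \<open>\<omega>\<close> itself, seen through the coarser \<open>hist n\<close>, so any
  \<open>hist n\<close>-measurable dependence is allowed. Both measures agree on rectangles, which
  are stable under intersection and generate the product.\<close>

lemma transition_distr: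
  "distr M (hist n \<Otimes>\<^sub>M borel) (\<lambda>\<omega>. (\<omega>, Y (Suc n) \<omega>)) =
   M \<bind> (\<lambda>\<omega>. distr (P (\<Gamma> n \<omega>) (Y n \<omega>)) (hist n \<Otimes>\<^sub>M borel) (Pair \<omega>))" (is "?L = M \<bind> ?K")
proof -
  let ?N = "hist n \<Otimes>\<^sub>M (borel :: ('x \<times> 'p) measure)"
  note p = measurable_hist_pair[of n] and K = measurable_hist_kernel[of n]
  let ?E = "{a \<times> b | a b. a \<in> sets (hist n) \<and> b \<in> sets (borel :: ('x \<times> 'p) measure)}"
  let ?\<Omega> = "space M \<times> (UNIV :: ('x \<times> 'p) set)"
  show ?thesis
  proof (rule measure_eqI_generator_eq[where \<Omega>="?\<Omega>" and E="?E" and A="\<lambda>_. ?\<Omega>"])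
    show "Int_stable ?E" by (rule Int_stable_pair_measure_generator)
    show "?E \<subseteq> Pow ?\<Omega>" using sets.sets_into_space[of _ "hist n"] by auto
    show "sets ?L = sigma_sets ?\<Omega> ?E"
      by (simp add: sets_pair_measure)
    have "sets (M \<bind> ?K) = sets ?N"
      by (rule sets_bind) (auto simp: not_empty)
    then show "sets (M \<bind> ?K) = sigma_sets ?\<Omega> ?E" by (simp add: sets_pair_measure)
    have "space M \<in> sets (hist n)" using sets.top[of "hist n"] by simp
    then have "?\<Omega> \<in> ?E" by (intro CollectI exI[of _ "space M"] exI[of _ UNIV]) simp
    then show "range (\<lambda>_::nat. ?\<Omega>) \<subseteq> ?E" by (rule image_subsetI)
    fix X assume "X \<in> ?E"
    then obtain A B where X: "X = A \<times> B" and A[measurable]: "A \<in> sets (hist n)" 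
      and B[measurable]: "B \<in> sets borel" by auto
    have AM: "A \<subseteq> space M" using sets.sets_into_space[OF A] by simp
    have XN: "X \<in> sets ?N" unfolding X by measurable
    have "emeasure ?L X = emeasure M ((\<lambda>\<omega>. (\<omega>, Y (Suc n) \<omega>)) -` X \<inter> space M)"
      by (rule emeasure_distr[OF p XN])
    also have "(\<lambda>\<omega>. (\<omega>, Y (Suc n) \<omega>)) -` X \<inter> space M = A \<inter> (Y (Suc n) -` B \<inter> space M)"
      unfolding X using AM by auto
    also have "emeasure M \<dots> = (\<integral>\<^sup>+\<omega>. indicator A \<omega> * emeasure (P (\<Gamma> n \<omega>) (Y n \<omega>)) B \<partial>M)"
      by (rule transition_rectangle[OF A B])
    also have "\<dots> = (\<integral>\<^sup>+\<omega>. emeasure (?K \<omega>) X \<partial>M)"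
    proof (rule nn_integral_cong)
      fix \<omega> assume \<omega>: "\<omega> \<in> space M"
      note mk = markov_kernelD[OF kernel[OF Gamma_in[OF \<omega>, of n]], of "Y n \<omega>"]
      have "Pair \<omega> \<in> P (\<Gamma> n \<omega>) (Y n \<omega>) \<rightarrow>\<^sub>M ?N"
        using \<omega> mk(2) by (simp cong: measurable_cong_sets)
      then have "emeasure (?K \<omega>) X = emeasure (P (\<Gamma> n \<omega>) (Y n \<omega>)) (Pair \<omega> -` X)"
        by (simp only: emeasure_distr[OF _ XN] mk(3) Int_UNIV_right)
      \<comment> \<open>The section of the rectangle at \<open>\<omega>\<close> is \<open>B\<close>
        if \<open>\<omega> \<in> A\<close> and empty otherwise.\<close>
      also have "\<dots> = indicator A \<omega> * emeasure (P (\<Gamma> n \<omega>) (Y n \<omega>)) B"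
        unfolding X by (auto simp: indicator_def)
      finally show "indicator A \<omega> * emeasure (P (\<Gamma> n \<omega>) (Y n \<omega>)) B = emeasure (?K \<omega>) X" by simp
    qed
    also have "\<dots> = emeasure (M \<bind> ?K) X"
      by (rule emeasure_bind[OF not_empty K XN, symmetric])
    finally show "emeasure ?L X = emeasure (M \<bind> ?K) X" .
  next
    have "emeasure ?L ?\<Omega> \<le> 1"
      by (rule prob_space.emeasure_le_1[OF prob_space_distr[OF p]])
    then show "emeasure ?L ?\<Omega> \<noteq> \<infinity>" by (auto simp: top_unique)
  qed auto
qed

text \<open>The Markov property for integrands that depend jointly on the past and the next state:
  given the past, the next state may be integrated out with the past held fixed.\<close>

lemma nn_integral_transition:
  assumes G: "(\<lambda>(\<omega>, y). G \<omega> y) \<in> borel_measurable (hist n \<Otimes>\<^sub>M borel)"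
  shows "(\<integral>\<^sup>+\<omega>. G \<omega> (Y (Suc n) \<omega>) \<partial>M) = (\<integral>\<^sup>+\<omega>. \<integral>\<^sup>+y. G \<omega> y \<partial>P (\<Gamma> n \<omega>) (Y n \<omega>) \<partial>M)"
proof -
  let ?N = "hist n \<Otimes>\<^sub>M (borel :: ('x \<times> 'p) measure)"
  let ?K = "\<lambda>\<omega>. distr (P (\<Gamma> n \<omega>) (Y n \<omega>)) ?N (Pair \<omega>)"
  note p = measurable_hist_pair[of n] and K = measurable_hist_kernel[of n]
  have "(\<integral>\<^sup>+\<omega>. G \<omega> (Y (Suc n) \<omega>) \<partial>M) = (\<integral>\<^sup>+z. (\<lambda>(\<omega>, y). G \<omega> y) z \<partial>distr M ?N (\<lambda>\<omega>. (\<omega>, Y (Suc n) \<omega>)))"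
    using G by (subst nn_integral_distr[OF p]) auto
  also have "\<dots> = (\<integral>\<^sup>+\<omega>. \<integral>\<^sup>+z. (\<lambda>(\<omega>, y). G \<omega> y) z \<partial>?K \<omega> \<partial>M)"
    unfolding transition_distr by (rule nn_integral_bind[OF G K])
  also have "\<dots> = (\<integral>\<^sup>+\<omega>. \<integral>\<^sup>+y. G \<omega> y \<partial>P (\<Gamma> n \<omega>) (Y n \<omega>) \<partial>M)"
  proof (rule nn_integral_cong)
    fix \<omega> assume \<omega>: "\<omega> \<in> space M"
    note mk = markov_kernelD[OF kernel[OF Gamma_in[OF \<omega>, of n]], of "Y n \<omega>"]
    have "Pair \<omega> \<in> P (\<Gamma> n \<omega>) (Y n \<omega>) \<rightarrow>\<^sub>M ?N"
      using \<omega> mk(2) by (simp cong: measurable_cong_sets)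
    moreover have "(\<lambda>(\<omega>, y). G \<omega> y) \<in> borel_measurable (?K \<omega>)"
      using G by (simp only: measurable_distr_eq1)
    ultimately show "(\<integral>\<^sup>+z. (\<lambda>(\<omega>, y). G \<omega> y) z \<partial>?K \<omega>) = (\<integral>\<^sup>+y. G \<omega> y \<partial>P (\<Gamma> n \<omega>) (Y n \<omega>))"
      by (simp only: nn_integral_distr prod.case)
  qed
  finally show ?thesis .
qed

text \<open>Both terms of an increment carry the same parameter \<open>\<Gamma> k \<omega>\<close>,
  which is known at time \<open>k\<close>; hence, for bounded jointly measurable \<open>u\<close>,
  the increments are martingale differences for \<open>hist\<close>.\<close>

definition mart_part :: "('i \<Rightarrow> 'x \<times> 'p \<Rightarrow> real) \<Rightarrow> nat \<Rightarrow> 'o \<Rightarrow> real" where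
  "mart_part u n \<omega> = (\<Sum>k<n. u (\<Gamma> k \<omega>) (Y (Suc k) \<omega>) - kernel_op (P (\<Gamma> k \<omega>)) (u (\<Gamma> k \<omega>)) (Y k \<omega>))"

section \<open>Adaptedness, exponential tails and growth of the martingale\<close>

lemma mart_part_measurable_hist:
  assumes u: "(\<lambda>(\<gamma>, y). u \<gamma> y) \<in> borel_measurable (J \<Otimes>\<^sub>M borel)"
  shows "mart_part u n \<in> borel_measurable (hist n)"
  unfolding mart_part_def[abs_def]
proof (intro borel_measurable_sum borel_measurable_diff)
  fix k assume "k \<in> {..<n}"
  then have k: "k < n" by simp
  have "(\<lambda>\<omega>. (\<Gamma> k \<omega>, Y (Suc k) \<omega>)) \<in> hist n \<rightarrow>\<^sub>M J \<Otimes>\<^sub>M borel"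
    using k by (intro measurable_Pair Y_hist Gamma_hist) auto
  from measurable_compose[OF this u]
  show "(\<lambda>\<omega>. u (\<Gamma> k \<omega>) (Y (Suc k) \<omega>)) \<in> borel_measurable (hist n)" by simp
  have "(\<lambda>\<omega>. (\<Gamma> k \<omega>, Y k \<omega>)) \<in> hist n \<rightarrow>\<^sub>M J \<Otimes>\<^sub>M borel"
    using k by (intro measurable_Pair Y_hist Gamma_hist) auto
  from measurable_compose[OF this kernel_op_joint_measurable[OF u]]
  show "(\<lambda>\<omega>. kernel_op (P (\<Gamma> k \<omega>)) (u (\<Gamma> k \<omega>)) (Y k \<omega>)) \<in> borel_measurable (hist n)" by simp
qed

lemma mart_part_measurable:
  assumes "(\<lambda>(\<gamma>, y). u \<gamma> y) \<in> borel_measurable (J \<Otimes>\<^sub>M borel)"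
  shows "mart_part u n \<in> borel_measurable M"
  by (rule measurable_from_subalg[OF subalgebra_hist mart_part_measurable_hist[OF assms]])

text \<open>Given the past, the last increment is a centred variable with values in an interval of
  length \<open>2 * D\<close>, so Hoeffding's lemma bounds its exponential moment. Induction
  multiplies these factors.\<close>

lemma mart_part_exponential_moment:
  assumes u: "(\<lambda>(\<gamma>, y). u \<gamma> y) \<in> borel_measurable (J \<Otimes>\<^sub>M borel)"
    and D: "\<And>\<gamma> y. \<gamma> \<in> space J \<Longrightarrow> \<bar>u \<gamma> y\<bar> \<le> D" and l: "0 < l"
  shows "(\<integral>\<^sup>+\<omega>. ennreal (exp (l * mart_part u n \<omega>)) \<partial>M) \<le> ennreal (exp (l\<^sup>2 * D\<^sup>2 / 2)) ^ n"
proof (induction n)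
  case 0
  show ?case by (simp add: mart_part_def emeasure_space_1)
next
  case (Suc n)
  have em: "(\<lambda>\<omega>. ennreal (exp (l * mart_part u n \<omega>))) \<in> borel_measurable M"
    using mart_part_measurable[OF u, of n] by measurable
  \<comment> \<open>The first factor depends only on the past, the second also on the next state
    \<open>y\<close>; thus \<open>nn_integral_transition\<close> applies and the first factor leaves
    the inner integral.\<close>
  define G where "G \<omega> y = ennreal (exp (l * mart_part u n \<omega>)) *
      ennreal (exp (l * (u (\<Gamma> n \<omega>) y - kernel_op (P (\<Gamma> n \<omega>)) (u (\<Gamma> n \<omega>)) (Y n \<omega>))))" for \<omega> y
  note mart_part_measurable_hist[OF u, measurable] u[measurable] kernel_op_joint_measurable[OF u, measurable]
    Gamma_hist[OF order_refl, measurable] Y_hist[OF order_refl, measurable]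
  have Gm: "(\<lambda>(\<omega>, y). G \<omega> y) \<in> borel_measurable (hist n \<Otimes>\<^sub>M borel)"
  proof -
    have [measurable]: "(\<lambda>z. u (\<Gamma> n (fst z)) (snd z)) \<in> borel_measurable (hist n \<Otimes>\<^sub>M borel)"
      by measurable
    have [measurable]: "(\<lambda>\<omega>. kernel_op (P (\<Gamma> n \<omega>)) (u (\<Gamma> n \<omega>)) (Y n \<omega>)) \<in> borel_measurable (hist n)"
      by measurable
    show ?thesis unfolding G_def case_prod_beta' by measurable
  qed
  have "(\<integral>\<^sup>+\<omega>. ennreal (exp (l * mart_part u (Suc n) \<omega>)) \<partial>M) = (\<integral>\<^sup>+\<omega>. G \<omega> (Y (Suc n) \<omega>) \<partial>M)"
    by (simp add: mart_part_def G_def distrib_left exp_add ennreal_mult del: ennreal_mult')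
  also have "\<dots> = (\<integral>\<^sup>+\<omega>. \<integral>\<^sup>+y. G \<omega> y \<partial>P (\<Gamma> n \<omega>) (Y n \<omega>) \<partial>M)"
    by (rule nn_integral_transition[OF Gm])
  also have "\<dots> \<le> (\<integral>\<^sup>+\<omega>. ennreal (exp (l * mart_part u n \<omega>)) * ennreal (exp (l\<^sup>2 * D\<^sup>2 / 2)) \<partial>M)"
  proof (rule nn_integral_mono)
    fix \<omega> assume \<omega>: "\<omega> \<in> space M"
    let ?\<gamma> = "\<Gamma> n \<omega>"
    let ?Q = "P ?\<gamma> (Y n \<omega>)"
    have \<gamma>: "?\<gamma> \<in> space J" by (rule Gamma_in[OF \<omega>])
    note mk = markov_kernelD[OF kernel[OF \<gamma>], of "Y n \<omega>"]
    have ub: "u ?\<gamma> \<in> borel_measurable borel"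
      using measurable_compose[OF measurable_Pair1'[OF \<gamma>] u] by simp
    interpret Q: interval_bounded_random_variable ?Q "u ?\<gamma>" "-D" D
    proof (intro interval_bounded_random_variable.intro interval_bounded_random_variable_axioms.intro)
      show "prob_space ?Q" by (rule mk)
      show "u ?\<gamma> \<in> borel_measurable ?Q" using ub mk(2) by (simp cong: measurable_cong_sets)
      have "u ?\<gamma> y \<in> {-D..D}" for y using D[OF \<gamma>, of y] by (auto simp: abs_le_iff)
      then show "AE y in ?Q. u ?\<gamma> y \<in> {-D..D}" by simp
    qed
    have "(\<integral>\<^sup>+y. G \<omega> y \<partial>?Q) = ennreal (exp (l * mart_part u n \<omega>)) *
        (\<integral>\<^sup>+y. ennreal (exp (l * (u ?\<gamma> y - (\<integral>z. u ?\<gamma> z \<partial>?Q)))) \<partial>?Q)"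
      unfolding G_def kernel_op_def using Q.random_variable
      by (intro nn_integral_cmult) measurable
    also have "\<dots> \<le> ennreal (exp (l * mart_part u n \<omega>)) * ennreal (exp (l\<^sup>2 * (D - (-D))\<^sup>2 / 8))"
      by (intro mult_left_mono Q.Hoeffdings_lemma_nn_integral l) simp
    also have "l\<^sup>2 * (D - (-D))\<^sup>2 / 8 = l\<^sup>2 * D\<^sup>2 / 2" by (simp add: power2_eq_square)
    finally show "(\<integral>\<^sup>+y. G \<omega> y \<partial>?Q) \<le> ennreal (exp (l * mart_part u n \<omega>)) * ennreal (exp (l\<^sup>2 * D\<^sup>2 / 2))" .
  qed
  also have "\<dots> = (\<integral>\<^sup>+\<omega>. ennreal (exp (l * mart_part u n \<omega>)) \<partial>M) * ennreal (exp (l\<^sup>2 * D\<^sup>2 / 2))"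
    by (rule nn_integral_multc[OF em])
  also have "\<dots> \<le> ennreal (exp (l\<^sup>2 * D\<^sup>2 / 2)) ^ n * ennreal (exp (l\<^sup>2 * D\<^sup>2 / 2))"
    by (rule mult_right_mono[OF Suc]) simp
  finally show ?case by (simp add: mult.commute)
qed

text \<open>Chernoff's method: Markov's inequality for the exponential moment.\<close>

lemma mart_part_tail_upper:
  assumes u: "(\<lambda>(\<gamma>, y). u \<gamma> y) \<in> borel_measurable (J \<Otimes>\<^sub>M borel)"
    and D: "\<And>\<gamma> y. \<gamma> \<in> space J \<Longrightarrow> \<bar>u \<gamma> y\<bar> \<le> D" "0 < D" and t: "0 < t" and n: "0 < n"
  shows "prob {\<omega> \<in> space M. t \<le> mart_part u n \<omega>} \<le> exp (- t\<^sup>2 / (2 * real n * D\<^sup>2))"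
proof -
  note mart_part_measurable[OF u, measurable]
  \<comment> \<open>The minimiser of the exponent
    \<open>- l * t + n * (l\<^sup>2 * D\<^sup>2 / 2)\<close>.\<close>
  define l where "l = t / (n * D\<^sup>2)"
  have l: "0 < l" using t n D by (simp add: l_def)
  have "emeasure M {\<omega> \<in> space M. t \<le> mart_part u n \<omega>} \<le>
     emeasure M ({\<omega> \<in> space M. 1 \<le> ennreal (exp (- l * t)) * ennreal (exp (l * mart_part u n \<omega>))})"
  proof (rule emeasure_mono)
    have "1 \<le> ennreal (exp (- l * t)) * ennreal (exp (l * mart_part u n \<omega>))" if "t \<le> mart_part u n \<omega>" for \<omega>
    proof -
      have "exp (- l * t) * exp (l * mart_part u n \<omega>) = exp (l * (mart_part u n \<omega> - t))"
        by (simp add: exp_add[symmetric] algebra_simps)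
      moreover have "1 \<le> exp (l * (mart_part u n \<omega> - t))" using that l by simp
      ultimately show ?thesis
        by (simp add: ennreal_mult[symmetric])
    qed
    then show "{\<omega> \<in> space M. t \<le> mart_part u n \<omega>} \<subseteq>
      {\<omega> \<in> space M. 1 \<le> ennreal (exp (- l * t)) * ennreal (exp (l * mart_part u n \<omega>))}" by auto
  qed measurable
  also have "\<dots> \<le> ennreal (exp (- l * t)) * (\<integral>\<^sup>+\<omega>. ennreal (exp (l * mart_part u n \<omega>)) * indicator (space M) \<omega> \<partial>M)"
    by (rule nn_integral_Markov_inequality) measurable
  also have "(\<integral>\<^sup>+\<omega>. ennreal (exp (l * mart_part u n \<omega>)) * indicator (space M) \<omega> \<partial>M) =
      (\<integral>\<^sup>+\<omega>. ennreal (exp (l * mart_part u n \<omega>)) \<partial>M)"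
    by (intro nn_integral_cong) simp
  also have "ennreal (exp (- l * t)) * \<dots> \<le> ennreal (exp (- l * t)) * ennreal (exp (l\<^sup>2 * D\<^sup>2 / 2)) ^ n"
    by (intro mult_left_mono mart_part_exponential_moment[OF u D(1) l]) simp_all
  also have "\<dots> = ennreal (exp (- l * t + n * (l\<^sup>2 * D\<^sup>2 / 2)))"
    by (simp only: ennreal_power exp_ge_zero ennreal_mult[symmetric] exp_add exp_of_nat_mult zero_le_power)
  also have "- l * t + n * (l\<^sup>2 * D\<^sup>2 / 2) = - t\<^sup>2 / (2 * real n * D\<^sup>2)"
    using n D by (simp add: l_def field_simps power2_eq_square)
  finally show ?thesis by (simp add: emeasure_eq_measure)
qed

lemma mart_part_uminus: "mart_part (\<lambda>\<gamma> y. - u \<gamma> y) n \<omega> = - mart_part u n \<omega>"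
  by (simp add: mart_part_def kernel_op_def sum_negf[symmetric])

text \<open>The one-sided bound is used for \<open>u\<close> and for \<open>- u\<close>, whose
  martingale is the negative one.\<close>

lemma mart_part_tail:
  assumes u: "(\<lambda>(\<gamma>, y). u \<gamma> y) \<in> borel_measurable (J \<Otimes>\<^sub>M borel)"
    and D: "\<And>\<gamma> y. \<gamma> \<in> space J \<Longrightarrow> \<bar>u \<gamma> y\<bar> \<le> D" "0 < D" and t: "0 < t" and n: "0 < n"
  shows "prob {\<omega> \<in> space M. t \<le> \<bar>mart_part u n \<omega>\<bar>} \<le> 2 * exp (- t\<^sup>2 / (2 * real n * D\<^sup>2))"
proof -
  note mart_part_measurable[OF u, measurable]
  have u': "(\<lambda>(\<gamma>, y). - u \<gamma> y) \<in> borel_measurable (J \<Otimes>\<^sub>M borel)"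
    using u by (simp add: case_prod_beta')
  have "{\<omega> \<in> space M. t \<le> \<bar>mart_part u n \<omega>\<bar>} =
      {\<omega> \<in> space M. t \<le> mart_part u n \<omega>} \<union> {\<omega> \<in> space M. t \<le> mart_part (\<lambda>\<gamma> y. - u \<gamma> y) n \<omega>}"
    unfolding mart_part_uminus by auto
  also have "prob \<dots> \<le> prob {\<omega> \<in> space M. t \<le> mart_part u n \<omega>} + prob {\<omega> \<in> space M. t \<le> mart_part (\<lambda>\<gamma> y. - u \<gamma> y) n \<omega>}"
    by (rule measure_Un_le) (simp_all add: mart_part_uminus)
  also have "\<dots> \<le> exp (- t\<^sup>2 / (2 * real n * D\<^sup>2)) + exp (- t\<^sup>2 / (2 * real n * D\<^sup>2))"
  proof (rule add_mono)
    show "prob {\<omega> \<in> space M. t \<le> mart_part u n \<omega>} \<le> exp (- t\<^sup>2 / (2 * real n * D\<^sup>2))"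
      by (rule mart_part_tail_upper[OF u D t n])
    show "prob {\<omega> \<in> space M. t \<le> mart_part (\<lambda>\<gamma> y. - u \<gamma> y) n \<omega>} \<le> exp (- t\<^sup>2 / (2 * real n * D\<^sup>2))"
      by (rule mart_part_tail_upper[OF u' _ D(2) t n]) (simp add: D(1))
  qed
  finally show ?thesis by simp
qed

text \<open>At thresholds of order \<open>n powr (1 / 2 + e)\<close> the tail bound is a stretched
  exponential in \<open>n\<close>, hence summable, and Borel--Cantelli applies.\<close>

lemma mart_part_strong_law:
  assumes u: "(\<lambda>(\<gamma>, y). u \<gamma> y) \<in> borel_measurable (J \<Otimes>\<^sub>M borel)"
    and D: "\<And>\<gamma> y. \<gamma> \<in> space J \<Longrightarrow> \<bar>u \<gamma> y\<bar> \<le> D" "0 < D" and e: "0 < e"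
  shows "AE \<omega> in M. (\<lambda>n. mart_part u n \<omega> / real n powr (1 / 2 + e)) \<longlonglongrightarrow> 0"
proof -
  note mart_part_measurable[OF u, measurable]
  have ev: "AE \<omega> in M. \<forall>\<^sub>F n in sequentially. \<bar>mart_part u n \<omega>\<bar> < c * real n powr (1 / 2 + e)" if c: "0 < c" for c
  proof -
    define A where "A n = {\<omega> \<in> space M. c * real n powr (1 / 2 + e) \<le> \<bar>mart_part u n \<omega>\<bar>}" for n
    have A[measurable]: "A n \<in> sets M" for n unfolding A_def by measurable
    \<comment> \<open>The constant left in the exponent once the threshold is squared and divided by
      \<open>2 * real n * D\<^sup>2\<close>.\<close>
    define k where "k = c\<^sup>2 / (2 * D\<^sup>2)"
    have k: "0 < k" using c D by (simp add: k_def)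
    have bound: "prob (A n) \<le> 2 * exp (- k * real n powr (2 * e))" if n: "0 < n" for n
    proof -
      have "(c * real n powr (1 / 2 + e))\<^sup>2 / (2 * real n * D\<^sup>2) = k * ((real n powr (1 / 2 + e))\<^sup>2 / n)"
        by (simp add: k_def power_mult_distrib)
      also have "(real n powr (1 / 2 + e))\<^sup>2 = real n powr (1 + 2 * e)"
        using n by (simp add: power2_eq_square powr_add[symmetric])
      also have "\<dots> / n = real n powr (2 * e)" using n by (simp add: powr_add)
      finally show ?thesis
        using mart_part_tail[OF u D, of "c * real n powr (1 / 2 + e)" n] n c by (simp add: A_def)
    qed
    have "summable (\<lambda>n. prob (A n))"
    proof (rule summable_comparison_test_ev)
      have "\<forall>\<^sub>F n in sequentially. 2 * exp (- k * real n powr (2 * e)) \<le> 1 / real n ^ 2"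
        using k e by real_asymp
      then show "\<forall>\<^sub>F n in sequentially. norm (prob (A n)) \<le> 1 / real n ^ 2"
        using eventually_gt_at_top[of 0]
      proof eventually_elim
        case (elim n)
        have "norm (prob (A n)) = prob (A n)" by simp
        also have "\<dots> \<le> 1 / real n ^ 2" by (rule order_trans[OF bound[OF elim(2)] elim(1)])
        finally show ?case .
      qed
      show "summable (\<lambda>n. 1 / real n ^ 2)" using inverse_power_summable[of 2, where ?'a=real] by (simp only: inverse_eq_divide order_refl)
    qed
    then have "AE \<omega> in M. \<forall>\<^sub>F n in sequentially. \<omega> \<in> space M - A n"
      by (intro borel_cantelli_AE1) (auto simp: less_top[symmetric])
    then show ?thesis
    proof (rule AE_mp, intro AE_I2 impI)
      fix \<omega> assume "\<forall>\<^sub>F n in sequentially. \<omega> \<in> space M - A n"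
      then show "\<forall>\<^sub>F n in sequentially. \<bar>mart_part u n \<omega>\<bar> < c * real n powr (1 / 2 + e)"
        by (rule eventually_mono) (auto simp: A_def)
    qed
  qed
  \<comment> \<open>Only the countably many levels \<open>inverse (Suc m)\<close> are used, so the
    exceptional null sets can be united.\<close>
  have "AE \<omega> in M. \<forall>m. \<forall>\<^sub>F n in sequentially. \<bar>mart_part u n \<omega>\<bar> < inverse (Suc m) * real n powr (1 / 2 + e)"
    unfolding AE_all_countable by (intro allI ev) simp
  then show ?thesis
  proof (rule AE_mp, intro AE_I2 impI)
    fix \<omega> assume *: "\<forall>m. \<forall>\<^sub>F n in sequentially. \<bar>mart_part u n \<omega>\<bar> < inverse (Suc m) * real n powr (1 / 2 + e)"
    show "(\<lambda>n. mart_part u n \<omega> / real n powr (1 / 2 + e)) \<longlonglongrightarrow> 0"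
    proof (rule tendstoI)
      fix r :: real assume "0 < r"
      then obtain m where m: "inverse (Suc m) < r" using reals_Archimedean by blast
      from *[rule_format, of m] eventually_gt_at_top[of 0]
      show "\<forall>\<^sub>F n in sequentially. dist (mart_part u n \<omega> / real n powr (1 / 2 + e)) 0 < r"
      proof eventually_elim
        case (elim n)
        then have "\<bar>mart_part u n \<omega>\<bar> / real n powr (1 / 2 + e) < inverse (Suc m)" by (simp add: pos_divide_less_eq)
        then show ?case using m by simp
      qed
    qed
  qed
qed

end

section \<open>Counting adaptation times\<close>

lemma air_time_0 [simp]: "air_time \<beta> 0 = 0"
  by (simp add: air_time_def)

lemma air_time_Suc: "air_time \<beta> (Suc m) = air_time \<beta> m + nat \<lceil>real (Suc m) powr \<beta>\<rceil>"
  by (simp add: air_time_def)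

text \<open>Every block is nonempty, since its length is the ceiling of a positive real.\<close>

lemma air_time_less_Suc: "air_time \<beta> m < air_time \<beta> (Suc m)"
  by (simp add: air_time_Suc)

text \<open>As \<open>\<beta> < 1\<close>, each \<open>j \<le> m\<close> satisfies \<open>j powr
  \<beta> = j * j powr (\<beta> - 1) \<ge> j * m powr (\<beta> - 1)\<close>; summing over
  \<open>j\<close> and using that the sum of the first \<open>m\<close> integers is at least
  \<open>m * m / 2\<close> gives the bound.\<close>

lemma air_time_ge:
  assumes "0 < \<beta>" "\<beta> < 1"
  shows "real m powr (1 + \<beta>) / 2 \<le> real (air_time \<beta> m)"
proof (cases "m = 0")
  case False
  then have m: "0 < m" by simp
  have "real m powr (1 + \<beta>) / 2 = real m powr (\<beta> - 1) * (real m * real m / 2)"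
  proof -
    have "real m powr (1 + \<beta>) = real m powr (\<beta> - 1) * real m powr 2"
      using powr_add[of "real m" "\<beta> - 1" 2] by (simp only: diff_add_eq) (simp add: add.commute)
    then show ?thesis using m by (simp add: power2_eq_square)
  qed
  also have "\<dots> \<le> real m powr (\<beta> - 1) * (\<Sum>j=1..m. real j)"
  proof (rule mult_left_mono)
    have "2 * (\<Sum>j=1..m. real j) = real m * (real m + 1)" by (induction m) (auto simp: algebra_simps)
    then show "real m * real m / 2 \<le> (\<Sum>j=1..m. real j)" by (simp add: algebra_simps)
  qed simp
  also have "\<dots> = (\<Sum>j=1..m. real j * real m powr (\<beta> - 1))"
    by (subst mult.commute) (simp only: sum_distrib_right)
  also have "\<dots> \<le> (\<Sum>j=1..m. real (nat \<lceil>real j powr \<beta>\<rceil>))"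
  proof (rule sum_mono)
    fix j assume "j \<in> {1..m}"
    then have j: "1 \<le> j" "j \<le> m" by auto
    have "real m powr (\<beta> - 1) \<le> real j powr (\<beta> - 1)"
      using j assms by (intro powr_mono2') auto
    then have "real j * real m powr (\<beta> - 1) \<le> real j * real j powr (\<beta> - 1)"
      by (rule mult_left_mono) simp
    also have "\<dots> = real j powr \<beta>" using j by (simp add: powr_diff)
    also have "\<dots> \<le> real (nat \<lceil>real j powr \<beta>\<rceil>)" by (rule real_nat_ceiling_ge)
    finally show "real j * real m powr (\<beta> - 1) \<le> real (nat \<lceil>real j powr \<beta>\<rceil>)" .
  qed
  finally show ?thesis by (simp add: air_time_def)
qed simp

text \<open>Inverts the growth bound: if the \<open>m\<close>-th adaptation time is at most
  \<open>n\<close>, then \<open>m powr (1 + \<beta>) \<le> 2 * n\<close>.\<close>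

lemma card_air_times_le:
  assumes \<beta>: "0 < \<beta>" "\<beta> < 1"
  shows "real (card {k\<in>{..<n}. Suc k \<in> range (air_time \<beta>)}) \<le> (2 * real n) powr (1 / (1 + \<beta>))"
proof -
  define N where "N = nat \<lfloor>(2 * real n) powr (1 / (1 + \<beta>))\<rfloor>"
  have "Suc ` {k\<in>{..<n}. Suc k \<in> range (air_time \<beta>)} \<subseteq> air_time \<beta> ` {1..N}"
  proof safe
    fix k m assume k: "k < n" and m: "Suc k = air_time \<beta> m"
    \<comment> \<open>Index 0 is excluded because \<open>air_time \<beta> 0 = 0\<close> is not a
      successor.\<close>
    have "1 \<le> m" using m by (cases m) auto
    have "real m powr (1 + \<beta>) \<le> 2 * real n"
      using air_time_ge[OF \<beta>, of m] m k by simp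
    then have "(real m powr (1 + \<beta>)) powr (1 / (1 + \<beta>)) \<le> (2 * real n) powr (1 / (1 + \<beta>))"
      using \<beta> by (intro powr_mono2) auto
    then have "real m \<le> (2 * real n) powr (1 / (1 + \<beta>))"
      using \<beta> by (simp add: powr_powr)
    then have "m \<le> N" unfolding N_def by (simp add: le_nat_floor)
    then show "Suc k \<in> air_time \<beta> ` {1..N}" using m \<open>1 \<le> m\<close> by auto
  qed
  then have "card (Suc ` {k\<in>{..<n}. Suc k \<in> range (air_time \<beta>)}) \<le> card {1..N}"
    by (rule order_trans[OF card_mono[OF finite_imageI[OF finite_atLeastAtMost]] card_image_le]) simp
  then have "card {k\<in>{..<n}. Suc k \<in> range (air_time \<beta>)} \<le> N"
    by (simp add: card_image)
  then have "real (card {k\<in>{..<n}. Suc k \<in> range (air_time \<beta>)}) \<le> real N" by simp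
  also have "\<dots> \<le> (2 * real n) powr (1 / (1 + \<beta>))"
    unfolding N_def by (rule of_nat_floor) simp
  finally show ?thesis .
qed

text \<open>Induction on \<open>k\<close>, moving to the next block exactly when
  \<open>Suc k\<close> reaches the end of the current one.\<close>

lemma air_time_bracket: "\<exists>j. air_time \<beta> j \<le> k \<and> k < air_time \<beta> (Suc j)"
proof (induction k)
  case 0
  then show ?case by (intro exI[of _ 0]) (use air_time_less_Suc[of \<beta> 0] in simp)
next
  case (Suc k)
  then obtain j where j: "air_time \<beta> j \<le> k" "k < air_time \<beta> (Suc j)" by auto
  show ?case
  proof (cases "Suc k = air_time \<beta> (Suc j)")
    case True
    then show ?thesis using air_time_less_Suc[of \<beta> "Suc j"] by (intro exI[of _ "Suc j"]) simp
  next
    case False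
    then show ?thesis using j by (intro exI[of _ j]) simp
  qed
qed

section \<open>Decomposition along the Poisson equation\<close>

context air_mcmc
begin

text \<open>If no block starts at \<open>Suc k\<close>, then \<open>k\<close> and
  \<open>Suc k\<close> lie in the same block.\<close>

lemma Gamma_Suc_eq:
  assumes "Suc k \<notin> range (air_time \<beta>)" "\<omega> \<in> space M"
  shows "\<Gamma> (Suc k) \<omega> = \<Gamma> k \<omega>"
proof -
  obtain j where j: "air_time \<beta> j \<le> k" "k < air_time \<beta> (Suc j)"
    using air_time_bracket by blast
  moreover have "Suc k \<noteq> air_time \<beta> (Suc j)" using assms(1) by auto
  ultimately show ?thesis
    by (intro increasingly_rare[of _ j]) (use assms(2) in auto)
qed

text \<open>The constant \<open>6 * D\<close> collects two boundary values of \<open>u\<close>, at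
  most \<open>D\<close> each, and two of \<open>g\<close>, at most \<open>2 * D\<close>
  each.\<close>

lemma additive_functional_bound:
  assumes poisson: "\<And>\<gamma> y. \<gamma> \<in> space J \<Longrightarrow> u \<gamma> y - kernel_op (P \<gamma>) (u \<gamma>) y = g y"
    and D: "\<And>\<gamma> y. \<gamma> \<in> space J \<Longrightarrow> \<bar>u \<gamma> y\<bar> \<le> D" and \<beta>: "\<beta> < 1" and \<omega>: "\<omega> \<in> space M"
  shows "\<bar>\<Sum>j=1..n. g (Y j \<omega>)\<bar> \<le> \<bar>mart_part u n \<omega>\<bar> + 6 * D + 2 * D * (2 * real n) powr (1 / (1 + \<beta>))"
proof -
  note \<Gamma> = Gamma_in[OF \<omega>]
  have D0: "0 \<le> D" using D[OF \<Gamma>, of 0 "Y 0 \<omega>"] by simp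
  have g: "\<bar>g y\<bar> \<le> 2 * D" for y
  proof -
    have "\<bar>kernel_op (P (\<Gamma> 0 \<omega>)) (u (\<Gamma> 0 \<omega>)) y\<bar> \<le> D"
      by (rule kernel_op_bounded[OF kernel[OF \<Gamma>] D[OF \<Gamma>]])
    then show ?thesis using D[OF \<Gamma>, of 0 y] poisson[OF \<Gamma>, of 0 y] by linarith
  qed
  \<comment> \<open>The error made by switching parameter while the state stays fixed; it vanishes
    unless \<open>Suc k\<close> is an adaptation time.\<close>
  define R where "R k = u (\<Gamma> (Suc k) \<omega>) (Y (Suc k) \<omega>) - u (\<Gamma> k \<omega>) (Y (Suc k) \<omega>)" for k
  \<comment> \<open>The Poisson equation is used at times \<open>0\<close> to \<open>n - 1\<close>;
    the last two terms shift the summation range to \<open>1..n\<close>.\<close>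
  have "(\<Sum>j=1..n. g (Y j \<omega>)) = mart_part u n \<omega> + u (\<Gamma> 0 \<omega>) (Y 0 \<omega>) - u (\<Gamma> n \<omega>) (Y n \<omega>) + (\<Sum>k<n. R k)
      + g (Y n \<omega>) - g (Y 0 \<omega>)"
  proof (induction n)
    case (Suc n)
    then show ?case using poisson[OF \<Gamma>, of n "Y n \<omega>"] by (simp add: mart_part_def R_def)
  qed (simp add: mart_part_def)
  moreover have "\<bar>\<Sum>k<n. R k\<bar> \<le> 2 * D * (2 * real n) powr (1 / (1 + \<beta>))"
  proof -
    have R: "\<bar>R k\<bar> \<le> (if Suc k \<in> range (air_time \<beta>) then 2 * D else 0)" for k
      using D[OF \<Gamma>, of "Suc k" "Y (Suc k) \<omega>"] D[OF \<Gamma>, of k "Y (Suc k) \<omega>"] Gamma_Suc_eq[OF _ \<omega>, of k]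
      unfolding R_def by auto
    have "\<bar>\<Sum>k<n. R k\<bar> \<le> (\<Sum>k<n. if Suc k \<in> range (air_time \<beta>) then 2 * D else 0)"
      by (rule order_trans[OF sum_abs sum_mono[OF R]])
    also have "\<dots> = 2 * D * real (card {k\<in>{..<n}. Suc k \<in> range (air_time \<beta>)})"
      by (simp add: sum.inter_filter[symmetric])
    also have "\<dots> \<le> 2 * D * (2 * real n) powr (1 / (1 + \<beta>))"
      using card_air_times_le[OF beta_pos \<beta>] D0 by (intro mult_left_mono) auto
    finally show ?thesis .
  qed
  ultimately show ?thesis
    using D[OF \<Gamma>, of 0 "Y 0 \<omega>"] D[OF \<Gamma>, of n "Y n \<omega>"] g[of "Y n \<omega>"] g[of "Y 0 \<omega>"] by linarith
qed

text \<open>The condition on \<open>\<epsilon>\<close> enters twice: it makes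
  \<open>\<epsilon>\<close> positive, as the martingale requires, and it makes the normalisation
  outgrow the number of adaptation times.\<close>

lemma strong_law_of_poisson_equation:
  assumes u: "(\<lambda>(\<gamma>, y). u \<gamma> y) \<in> borel_measurable (J \<Otimes>\<^sub>M borel)"
    and poisson: "\<And>\<gamma> y. \<gamma> \<in> space J \<Longrightarrow> u \<gamma> y - kernel_op (P \<gamma>) (u \<gamma>) y = g y"
    and D: "\<And>\<gamma> y. \<gamma> \<in> space J \<Longrightarrow> \<bar>u \<gamma> y\<bar> \<le> D" "0 < D"
    and \<beta>: "\<beta> < 1" and eps: "\<epsilon> > 1 / (1 + \<beta>) - 1 / 2"
  shows "AE \<omega> in M. (\<lambda>n. 1 / real n powr (1 / 2 + \<epsilon>) * (\<Sum>j=1..n. g (Y j \<omega>))) \<longlonglongrightarrow> 0"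
proof -
  have "1 / 2 < 1 / (1 + \<beta>)" using beta_pos \<beta> by (simp add: field_simps)
  then have e: "0 < \<epsilon>" using eps by simp
  have "AE \<omega> in M. (\<lambda>n. mart_part u n \<omega> / real n powr (1 / 2 + \<epsilon>)) \<longlonglongrightarrow> 0"
    by (rule mart_part_strong_law[OF u D e])
  then show ?thesis
  proof (rule AE_mp, intro AE_I2 impI)
    fix \<omega> assume \<omega>: "\<omega> \<in> space M" and m: "(\<lambda>n. mart_part u n \<omega> / real n powr (1 / 2 + \<epsilon>)) \<longlonglongrightarrow> 0"
    define a where "a = 1 / 2 + \<epsilon>"
    define p where "p = 1 / (1 + \<beta>)"
    \<comment> \<open>The inequality \<open>p < a\<close> is the hypothesis on
      \<open>\<epsilon>\<close> rearranged.\<close>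
    have p: "0 < p" "p < a" using beta_pos eps by (auto simp: p_def a_def)
    let ?B = "\<lambda>n. \<bar>mart_part u n \<omega> / real n powr a\<bar> + (6 * D / real n powr a + 2 * D * ((2 * real n) powr p / real n powr a))"
    have "(\<lambda>n. 6 * D / real n powr a) \<longlonglongrightarrow> 0" using p by real_asymp
    moreover have "(\<lambda>n. (2 * real n) powr p / real n powr a) \<longlonglongrightarrow> 0" using p by real_asymp
    ultimately have "(\<lambda>n. 6 * D / real n powr a + 2 * D * ((2 * real n) powr p / real n powr a)) \<longlonglongrightarrow> 0 + 2 * D * 0"
      by (intro tendsto_add tendsto_mult tendsto_const)
    from tendsto_add[OF tendsto_rabs[OF m] this]
    have lim: "?B \<longlonglongrightarrow> \<bar>0\<bar> + (0 + 2 * D * 0)" unfolding a_def .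
    show "(\<lambda>n. 1 / real n powr (1 / 2 + \<epsilon>) * (\<Sum>j=1..n. g (Y j \<omega>))) \<longlonglongrightarrow> 0"
      unfolding a_def[symmetric]
    proof (rule tendsto_rabs_zero_cancel, rule tendsto_sandwich[where f="\<lambda>_. 0" and h="?B"])
      show "\<forall>\<^sub>F n in sequentially. \<bar>1 / real n powr a * (\<Sum>j=1..n. g (Y j \<omega>))\<bar> \<le> ?B n"
      \<comment> \<open>The bound includes \<open>n = 0\<close>, where division by zero gives 0 on
        both sides.\<close>
      proof (rule always_eventually, rule allI)
        fix n
        have "\<bar>1 / real n powr a * (\<Sum>j=1..n. g (Y j \<omega>))\<bar> = \<bar>\<Sum>j=1..n. g (Y j \<omega>)\<bar> / real n powr a"
          by (simp add: abs_mult)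
        also have "\<dots> \<le> (\<bar>mart_part u n \<omega>\<bar> + 6 * D + 2 * D * (2 * real n) powr p) / real n powr a"
          using additive_functional_bound[OF poisson D(1) \<beta> \<omega>, of n]
          unfolding p_def by (rule divide_right_mono) auto
        also have "\<dots> = ?B n" by (simp add: add_divide_distrib)
        finally show "\<bar>1 / real n powr a * (\<Sum>j=1..n. g (Y j \<omega>))\<bar> \<le> ?B n" .
      qed
      show "?B \<longlonglongrightarrow> 0" using lim by simp
    qed auto
  qed
qed

end

text \<open>The marginal condition as an equality of measures: functions of the first coordinate
  have the same mean under every \<open>\<pi> \<gamma>\<close>, so a single constant centres them
  for all parameters.\<close>

lemma (in air_setting) distr_pi_fst:
  assumes "\<gamma> \<in> space J"
  shows "distr (\<pi> \<gamma>) borel fst = \<nu>"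
proof (rule measure_eqI)
  fix B assume "B \<in> sets (distr (\<pi> \<gamma>) borel fst)"
  then have B: "B \<in> sets borel" by simp
  have f: "fst \<in> \<pi> \<gamma> \<rightarrow>\<^sub>M borel"
    using pi_sets[OF assms] borel_measurable_continuous_onI[OF continuous_on_fst[OF continuous_on_id]]
    by (simp cong: measurable_cong_sets)
  have "fst -` B \<inter> space (\<pi> \<gamma>) = B \<times> (UNIV :: 'p set)"
    using sets_eq_imp_space_eq[OF pi_sets[OF assms]] by auto
  then show "emeasure (distr (\<pi> \<gamma>) borel fst) B = emeasure \<nu> B"
    using pi_marginal[OF assms B] by (simp add: emeasure_distr[OF f B])
qed (simp add: nu_sets)

section \<open>Centring the test function and assembling the uniform constants\<close>

theorem theorem3p6:
  fixes \<nu> :: "'x::polish_space measure"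
    and J :: "'i measure"
    and \<pi> :: "'i \<Rightarrow> ('x \<times> 'p::polish_space) measure"
    and P :: "'i \<Rightarrow> 'x \<times> 'p \<Rightarrow> ('x \<times> 'p) measure"
    and M :: "'o measure"
    and \<beta> :: real
    and y0 :: "'x \<times> 'p"
    and \<gamma>0 :: 'i
    and U :: "nat \<Rightarrow> (nat \<Rightarrow> 'x \<times> 'p) \<times> (nat \<Rightarrow> 'i) \<Rightarrow> 'i"
    and Y :: "nat \<Rightarrow> 'o \<Rightarrow> 'x \<times> 'p"
    and \<Gamma> :: "nat \<Rightarrow> 'o \<Rightarrow> 'i"
    and d :: "'x \<times> 'p \<Rightarrow> 'x \<times> 'p \<Rightarrow> real"
    and B \<tau> K L \<epsilon> :: real
    and k0 :: nat
    and f :: "'x \<Rightarrow> real"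
    and h :: "'x \<times> 'p \<Rightarrow> real"
  assumes chain: "air_mcmc \<nu> J \<pi> P M \<beta> y0 \<gamma>0 U Y \<Gamma>"
    and beta: "0 < \<beta>" "\<beta> < 1"
    and d: "distance_like d"
    and B: "1 \<le> B"
    and tau: "0 \<le> \<tau>" "\<tau> < 1"
    and k0: "1 \<le> k0"
    and contraction_1: "\<And>\<gamma>. \<gamma> \<in> space J \<Longrightarrow> contraction_coeff d (P \<gamma>) \<le> ennreal B"
    and contraction_k0:
      "\<And>\<gamma>. \<gamma> \<in> space J \<Longrightarrow> contraction_coeff d (kernel_pow (P \<gamma>) k0) \<le> ennreal \<tau>"
    and K: "0 < K"
    and eccentricity_bound: "\<And>\<gamma> y. \<gamma> \<in> space J \<Longrightarrow> eccentricity d (\<pi> \<gamma>) y \<le> ennreal K"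
    and f_measurable: "f \<in> borel_measurable borel"
    and h: "h = (\<lambda>(x, \<phi>). f x)"
    and h_bounded: "bounded (range h)"
    and L: "0 < L"
    and h_lipschitz: "lipschitz_wrt d L h"
    and eps: "\<epsilon> > 1 / (1 + \<beta>) - 1 / 2"
  shows "AE \<omega> in M.
    (\<lambda>n. 1 / real n powr (1 / 2 + \<epsilon>) * (\<Sum>j=1..n. (f (fst (Y j \<omega>)) - (\<integral>x. f x \<partial>\<nu>))))
      \<longlonglongrightarrow> 0"
proof -
  interpret air_mcmc \<nu> J \<pi> P M \<beta> y0 \<gamma>0 U Y \<Gamma> by (rule chain)
  define c where "c = (\<integral>x. f x \<partial>\<nu>)"
  define g where "g = (\<lambda>y. h y - c)"
  have fst: "fst \<in> borel \<rightarrow>\<^sub>M (borel :: 'x measure)"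
    by (rule borel_measurable_continuous_onI[OF continuous_on_fst[OF continuous_on_id]])
  have h': "h = (\<lambda>y. f (fst y))" using h by (simp add: case_prod_beta')
  have hm: "h \<in> borel_measurable borel"
    unfolding h' by (rule measurable_compose[OF fst f_measurable])
  obtain C where C: "\<bar>h y\<bar> \<le> C" for y
    using h_bounded by (auto simp: bounded_iff)
  have gm: "g \<in> borel_measurable borel" unfolding g_def using hm by measurable
  have gC: "\<bar>g y\<bar> \<le> C + \<bar>c\<bar>" for y using C[of y] by (simp add: g_def)
  have g_lip: "lipschitz_wrt d L g"
    using h_lipschitz by (simp add: lipschitz_wrt_def g_def)
  have g0: "(\<integral>y. g y \<partial>\<pi> \<gamma>) = 0" if \<gamma>: "\<gamma> \<in> space J" for \<gamma>
  proof -
    interpret \<pi>: prob_space "\<pi> \<gamma>" by (rule pi_prob[OF \<gamma>])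
    have "integrable (\<pi> \<gamma>) h"
      by (rule integrable_bounded_borel[OF pi_prob[OF \<gamma>] pi_sets[OF \<gamma>] hm C])
    moreover have "(\<integral>y. h y \<partial>\<pi> \<gamma>) = (\<integral>x. f x \<partial>distr (\<pi> \<gamma>) borel fst)"
      unfolding h' using fst pi_sets[OF \<gamma>]
      by (intro integral_distr[symmetric] f_measurable) (simp cong: measurable_cong_sets)
    ultimately show ?thesis by (simp add: g_def c_def distr_pi_fst[OF \<gamma>] \<pi>.prob_space)
  qed
  \<comment> \<open>Replaces \<open>\<tau>\<close>, which may be 0, by a positive rate below 1: the
    decay estimate divides by \<open>t\<close> and needs positive Lipschitz constants.\<close>
  define t where "t = max \<tau> (1 / 2)"
  have t: "0 < t" "t < 1" using tau by (auto simp: t_def)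
  define r where "r = t powr (1 / k0)"
  have r: "0 \<le> r" "r < 1"
    using t k0 powr_less_mono2[of "1 / k0" t 1] by (auto simp: r_def)
  define A where "A = B ^ k0 * L * K / t"
  have A: "0 < A" using B L K t by (simp add: A_def)
  have geo: "\<bar>(kernel_op (P \<gamma>) ^^ n) g y\<bar> \<le> A * r ^ n" if \<gamma>: "\<gamma> \<in> space J" for \<gamma> n y
    unfolding A_def r_def
  proof (rule funpow_kernel_op_geometric[OF pi_prob[OF \<gamma>] pi_sets[OF \<gamma>] kernel[OF \<gamma>] invariant[OF \<gamma>] gm gC g0[OF \<gamma>]
        d g_lip L contraction_1[OF \<gamma>] B _ t k0 eccentricity_bound[OF \<gamma>]])
    show "contraction_coeff d (kernel_pow (P \<gamma>) k0) \<le> ennreal t"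
      by (rule order_trans[OF contraction_k0[OF \<gamma>]]) (simp add: t_def ennreal_leI)
  qed (use K in simp)
  have "AE \<omega> in M. (\<lambda>n. 1 / real n powr (1 / 2 + \<epsilon>) * (\<Sum>j=1..n. g (Y j \<omega>))) \<longlonglongrightarrow> 0"
  \<comment> \<open>\<open>A / (1 - r)\<close> is the sum of the geometric bounds on the terms of
    the series; it does not depend on the parameter.\<close>
  proof (rule strong_law_of_poisson_equation[where u="\<lambda>\<gamma>. poisson_solution (P \<gamma>) g" and D="A / (1 - r)"])
    show "(\<lambda>(\<gamma>, y). poisson_solution (P \<gamma>) g y) \<in> borel_measurable (J \<Otimes>\<^sub>M borel)"
      by (rule poisson_solution_joint_measurable[OF gm])
    fix \<gamma> y assume \<gamma>: "\<gamma> \<in> space J"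
    show "poisson_solution (P \<gamma>) g y - kernel_op (P \<gamma>) (poisson_solution (P \<gamma>) g) y = g y"
      by (rule poisson_equation[OF kernel[OF \<gamma>] gm geo[OF \<gamma>] r])
    show "\<bar>poisson_solution (P \<gamma>) g y\<bar> \<le> A / (1 - r)"
      by (rule poisson_solution_bounded[OF geo[OF \<gamma>] r])
  qed (use A r beta eps in auto)
  then show ?thesis by (simp add: g_def h' c_def)
qed

end
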